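(* Let $0<s<1$ and let $\Omega:S^1\to\mathbb{R}$ be smooth, strictly positive, with $\Omega(\theta+\pi)=\Omega(\theta)$, and such that $\tilde\Omega\ge c$ for some constant $c>0$, where $\tilde\Omega$ is the angular part of the Fourier transform of $|\mathbf{x}|^{-s}\Omega(\theta)$ (defined in the context). Let $(a(t),b(t))$ solve $$a'(t)=2\big(A(a(t),b(t))-1\big)a(t),\qquad b'(t)=2\big(B(a(t),b(t))-1\big)b(t)$$ with initial condition $(a_0,b_0)\in(0,\infty)^2$, where $$\begin{pmatrix}A(a,b)\\ B(a,b)\end{pmatrix}=\tau_s(R_1/R_2)^{2+s}\int_{-\pi}^{\pi}(a^2\cos^2\varphi+b^2\sin^2\varphi)^{-(2+s)/2}\begin{pmatrix}\cos^2\varphi\\ \sin^2\varphi\end{pmatrix}\tilde\Omega(\varphi)\,\mathrm{d}\varphi .$$ Let $(a_\infty,b_\infty)\in(0,\infty)^2$ denote the unique solution to $A(a,b)=B(a,b)=1$, and let $$\mathcal{E}(a,b)=\tau_s(R_1/R_2)^{2+s}\int_{-\pi}^{\pi}(a^2\cos^2\varphi+b^2\sin^2\varphi)^{-s/2}\tilde\Omega(\varphi)\,\mathrm{d}\varphi+\frac{s}{2}(a^2+b^2).$$ Then we have the exponential convergence in energy $$\mathcal{E}(a(t),b(t))-\mathcal{E}(a_\infty,b_\infty)\le Ce^{-\lambda t}$$ for some $C,\lambda>0$. Also, $(a(t),b(t))\to(a_\infty,b_\infty)$ as $t\to\infty$.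
   Context: $S^1=[-\pi,\pi)$ is the set of angles (mod $2\pi$); $\theta$ is the angle of $\mathbf{x}\in\mathbb{R}^2\setminus\{0\}$, i.e. $\mathbf{x}/|\mathbf{x}|=(\cos\theta,\sin\theta)$. The Fourier transform is $\mathcal{F}[f](\xi)=\int_{\mathbb{R}^2}f(\mathbf{x})e^{-2\pi i\mathbf{x}\cdot\xi}\,\mathrm{d}\mathbf{x}$ (extended to tempered distributions). Writing $\xi=|\xi|(\cos\varphi,\sin\varphi)$, $\tilde\Omega$ is defined by $\mathcal{F}[|\mathbf{x}|^{-s}\Omega(\theta)](\xi)=|\xi|^{-2+s}\tilde\Omega(\varphi)$; explicitly, $$\tilde\Omega(\varphi)=\tau_{2-s}\int_{-\pi}^{\pi}|\cos(\varphi-\theta)|^{-2+s}\Big(\Omega(\theta)-\Omega(\varphi+\tfrac{\pi}{2})\Big)\mathrm{d}\theta+c_s\,\Omega(\varphi+\tfrac{\pi}{2}),$$ with $\tau_r=(2\pi)^{-r}\Gamma(r)\cos\frac{r\pi}{2}$ for $0<r<2$ and $c_s=\pi^{s-1}\frac{\Gamma((2-s)/2)}{\Gamma(s/2)}$. Constants: $R_1=\Big(\frac{2\cos\frac{s\pi}{2}}{s(s+1)\pi}\beta\big(\frac12,\frac{3+s}{2}\big)\Big)^{-\frac{1}{s+2}}$ ($\beta$ is the Beta function), $R_2=\Big(\frac{8\sin\frac{s\pi}{2}}{s^2(2+s)\pi}\Big)^{-\frac{1}{s+2}}$. *)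

theory Defs
  imports "HOL-Analysis.Analysis"
begin

text \<open>
  Functions on the circle are represented by their periodic extensions to \<open>real\<close>.
\<close>

definition smooth_fun :: "(real \<Rightarrow> real) \<Rightarrow> bool" where
  "smooth_fun f \<longleftrightarrow> (\<forall>n x. (deriv ^^ n) f differentiable (at x))"

definition tau :: "real \<Rightarrow> real" where
  "tau r = (2 * pi) powr (- r) * Gamma r * cos (r * pi / 2)"

definition c_const :: "real \<Rightarrow> real" where
  "c_const s = pi powr (s - 1) * Gamma ((2 - s) / 2) / Gamma (s / 2)"

text \<open>
  The angular part of the Fourier transform of \<open>\<bar>x\<bar> powr (- s) * \<Omega> \<theta>\<close> on the plane
  (with kernel \<open>exp (- 2 * pi * \<i> * (x \<bullet> \<xi>))\<close>), which is
  \<open>\<bar>\<xi>\<bar> powr (- 2 + s) * Omega_tilde s \<Omega> \<phi>\<close>, given by its explicit formula.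
  For \<open>0 < s < 1\<close> and smooth \<open>\<Omega>\<close> with \<open>\<Omega> (\<theta> + pi) = \<Omega> \<theta>\<close> the integrand is absolutely
  integrable: both zeros of \<open>cos (\<phi> - \<theta>)\<close> are zeros of the second factor. The value \<open>0\<close> that
  \<open>powr\<close> takes at these two points does not matter.
\<close>

definition Omega_tilde :: "real \<Rightarrow> (real \<Rightarrow> real) \<Rightarrow> real \<Rightarrow> real" where
  "Omega_tilde s \<Omega> \<phi> =
     tau (2 - s) * (LBINT \<theta>:{-pi..pi}.
        \<bar>cos (\<phi> - \<theta>)\<bar> powr (- 2 + s) * (\<Omega> \<theta> - \<Omega> (\<phi> + pi / 2)))
     + c_const s * \<Omega> (\<phi> + pi / 2)"

definition R1 :: "real \<Rightarrow> real" where
  "R1 s = (2 * cos (s * pi / 2) / (s * (s + 1) * pi) * Beta (1 / 2) ((3 + s) / 2))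
            powr (- (1 / (s + 2)))"

definition R2 :: "real \<Rightarrow> real" where
  "R2 s = (8 * sin (s * pi / 2) / (s\<^sup>2 * (2 + s) * pi)) powr (- (1 / (s + 2)))"

definition A_fun :: "real \<Rightarrow> (real \<Rightarrow> real) \<Rightarrow> real \<Rightarrow> real \<Rightarrow> real" where
  "A_fun s \<Omega> a b = tau s * (R1 s / R2 s) powr (2 + s) *
     (LBINT \<phi>:{-pi..pi}.
        (a\<^sup>2 * (cos \<phi>)\<^sup>2 + b\<^sup>2 * (sin \<phi>)\<^sup>2) powr (- (2 + s) / 2)
        * (cos \<phi>)\<^sup>2 * Omega_tilde s \<Omega> \<phi>)"

definition B_fun :: "real \<Rightarrow> (real \<Rightarrow> real) \<Rightarrow> real \<Rightarrow> real \<Rightarrow> real" where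
  "B_fun s \<Omega> a b = tau s * (R1 s / R2 s) powr (2 + s) *
     (LBINT \<phi>:{-pi..pi}.
        (a\<^sup>2 * (cos \<phi>)\<^sup>2 + b\<^sup>2 * (sin \<phi>)\<^sup>2) powr (- (2 + s) / 2)
        * (sin \<phi>)\<^sup>2 * Omega_tilde s \<Omega> \<phi>)"

definition energy :: "real \<Rightarrow> (real \<Rightarrow> real) \<Rightarrow> real \<Rightarrow> real \<Rightarrow> real" where
  "energy s \<Omega> a b = tau s * (R1 s / R2 s) powr (2 + s) *
     (LBINT \<phi>:{-pi..pi}.
        (a\<^sup>2 * (cos \<phi>)\<^sup>2 + b\<^sup>2 * (sin \<phi>)\<^sup>2) powr (- s / 2) * Omega_tilde s \<Omega> \<phi>)
     + s / 2 * (a\<^sup>2 + b\<^sup>2)"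

definition equilibrium :: "real \<Rightarrow> (real \<Rightarrow> real) \<Rightarrow> real \<times> real" where
  "equilibrium s \<Omega> =
     (THE p. 0 < fst p \<and> 0 < snd p \<and>
        A_fun s \<Omega> (fst p) (snd p) = 1 \<and> B_fun s \<Omega> (fst p) (snd p) = 1)"

definition solves_flow ::
  "real \<Rightarrow> (real \<Rightarrow> real) \<Rightarrow> (real \<Rightarrow> real) \<Rightarrow> (real \<Rightarrow> real) \<Rightarrow> bool" where
  "solves_flow s \<Omega> a b \<longleftrightarrow>
     (\<forall>t\<ge>0.
        (a has_real_derivative 2 * (A_fun s \<Omega> (a t) (b t) - 1) * a t) (at t within {0..}) \<and>
        (b has_real_derivative 2 * (B_fun s \<Omega> (a t) (b t) - 1) * b t) (at t within {0..}))"

end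

theory Submission
  imports Defs
begin

text \<open>
  In the variables \<open>u = a\<^sup>2\<close>, \<open>v = b\<^sup>2\<close> the system becomes \<open>u' = 4 (A - 1) u\<close>,
  \<open>v' = 4 (B - 1) v\<close>, while the energy \<open>E\<close> is a convex function of \<open>(u, v)\<close> with gradient
  \<open>s / 2 (1 - A, 1 - B)\<close>: it integrates the convex function \<open>x \<mapsto> x powr (- s / 2)\<close> of
  \<open>x = u cos\<^sup>2 \<phi> + v sin\<^sup>2 \<phi>\<close> against a positive measure on the circle. Hence the flow is,
  up to a constant factor, the gradient flow of \<open>E\<close> for the metric \<open>du\<^sup>2 / u + dv\<^sup>2 / v\<close>.

  For such a flow the natural distance to the equilibrium \<open>(u*, v*)\<close> is the relative entropy
  \<open>L = u - u* - u* ln (u / u*) + v - v* - v* ln (v / v*)\<close>, because the factors \<open>u\<close> and \<open>v\<close> of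
  the flow cancel in \<open>L' = 4 ((A - 1) (u - u*) + (B - 1) (v - v*))\<close>. Convexity of \<open>E\<close> gives
  \<open>L' \<le> 0\<close>, and since \<open>L\<close> blows up at the boundary of the quadrant, the orbit stays in a compact
  subset of the open quadrant. On that set \<open>E\<close> is strongly convex
  (\<open>force_strongly_monotone\<close>) and \<open>L\<close> is comparable to the squared distance to \<open>(u*, v*)\<close>
  (\<open>rel_entropy_upper\<close>, \<open>rel_entropy_lower\<close>). So \<open>L' \<le> - k L\<close> for some \<open>k > 0\<close>, which yields
  exponential decay of the distance and, \<open>E\<close> being Lipschitz there, of the energy gap. This is
  \<open>flow_converges_exponentially\<close>. The convexity of \<open>E\<close> comes from one-variable
  inequalities for powers, integrated over the circle.

  The equilibrium exists because \<open>E\<close> has a minimum over a large square \<open>[m, M]\<^sup>2\<close>, and this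
  minimum is interior: the term \<open>s / 2 (u + v)\<close> keeps it away from \<open>u = M\<close> and \<open>v = M\<close>, and the
  force \<open>A\<close> exceeds \<open>1\<close> near the axis \<open>u = 0\<close>, as \<open>B\<close> does near \<open>v = 0\<close>, since the
  measure has a density bounded below (\<open>force_gt_1_near_axis\<close>). It is unique by strong
  monotonicity.

  It remains to see that \<open>Omega_tilde s \<Omega>\<close> is the density of a finite measure. The factor
  \<open>\<bar>cos (\<phi> - \<theta>)\<bar> powr (s - 2)\<close> is not integrable, but by periodicity \<open>\<Omega> \<theta> - \<Omega> (\<phi> + pi / 2)\<close>
  vanishes at least linearly at both of its singularities, which leaves the integrable power \<open>s - 1\<close>
  (\<open>Omega_tilde_bounded\<close>).
\<close>

section \<open>Convexity of negative powers\<close>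

text \<open>
  The tangent line inequality for \<open>x powr (- k)\<close>; dividing by \<open>x powr (- k)\<close> reduces it to
  \<open>exp z \<ge> 1 + z\<close> and \<open>ln z \<le> z - 1\<close>.
\<close>

lemma powr_neg_tangent:
  fixes x y k :: real
  assumes "0 < x" "0 < y" "0 \<le> k"
  shows "x powr (- k) - y powr (- k) \<le> - k * (x powr (- k - 1) * (x - y))"
proof -
  have "ln (y / x) \<le> y / x - 1" using assms by (intro ln_le_minus_one) simp
  hence "1 - k * (y / x - 1) \<le> 1 + (- k * ln (y / x))" using assms
    by (simp add: mult_left_mono)
  also have "\<dots> \<le> exp (- k * ln (y / x))" by (rule exp_ge_add_one_self)
  also have "\<dots> = (y / x) powr (- k)" using assms by (simp add: powr_def)
  also have "\<dots> = y powr (- k) / x powr (- k)" using assms by (simp add: powr_divide)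
  finally have "x powr (- k) * (1 - k * (y / x - 1)) \<le> y powr (- k)"
    using assms by (simp add: field_simps)
  moreover have "x powr (- k) = x powr (- k - 1) * x" using assms
    by (simp add: powr_diff)
  hence "x powr (- k) * (1 - k * (y / x - 1)) = x powr (- k) - k * (x powr (- k - 1) * (y - x))"
    using assms by (simp add: field_simps)
  ultimately show ?thesis by (simp add: algebra_simps)
qed

text \<open>
  On \<open>(0, M]\<close> the slope of \<open>x powr (- k)\<close> is at most its value at \<open>M\<close>. This is the source of
  every strong convexity constant below.
\<close>

lemma powr_neg_strongly_decreasing:
  fixes x y M k :: real
  assumes "0 < x" "x \<le> M" "0 < y" "y \<le> M" "0 \<le> k"
  shows "(x powr (- k) - y powr (- k)) * (x - y) \<le> - (k * M powr (- k - 1)) * (x - y)\<^sup>2"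
proof -
  have *: "(x powr (- k) - y powr (- k)) * (x - y) \<le> - (k * M powr (- k - 1)) * (x - y)\<^sup>2"
    if H: "0 < x" "x < y" "y \<le> M" for x y
  proof -
    have "\<exists>z. x < z \<and> z < y \<and> y powr (- k) - x powr (- k) = (y - x) * (- k * z powr (- k - 1))"
      by (rule MVT2) (use H in \<open>auto intro!: derivative_eq_intros simp: powr_diff field_simps\<close>)
    then obtain z where z: "x < z" "z < y"
      "y powr (- k) - x powr (- k) = (y - x) * (- k * z powr (- k - 1))" by blast
    have "M powr (- k - 1) \<le> z powr (- k - 1)"
      by (rule powr_mono2') (use z H assms in auto)
    hence "k * M powr (- k - 1) * (x - y)\<^sup>2 \<le> k * z powr (- k - 1) * (x - y)\<^sup>2"
      using assms by (intro mult_right_mono mult_left_mono) auto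
    moreover have "(x powr (- k) - y powr (- k)) * (x - y) = (y powr (- k) - x powr (- k)) * (y - x)"
      by (simp add: algebra_simps)
    hence "(x powr (- k) - y powr (- k)) * (x - y) = - (k * z powr (- k - 1)) * (x - y)\<^sup>2"
      unfolding z(3) by (simp add: power2_eq_square algebra_simps)
    ultimately show ?thesis by simp
  qed
  consider "x < y" | "x = y" | "y < x" by linarith
  then show ?thesis
  proof cases
    case 3
    have "(y powr (- k) - x powr (- k)) * (y - x) \<le> - (k * M powr (- k - 1)) * (y - x)\<^sup>2"
      by (rule *) (use 3 assms in auto)
    then show ?thesis by (simp add: algebra_simps power2_commute)
  qed (use * assms in auto)
qed

lemma powr_tendsto_1: "((\<lambda>l :: real. l powr k) \<longlongrightarrow> 1) (at_right 1)"
  by (auto intro!: tendsto_eq_intros)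

section \<open>The energy and the forces of a measure with two weights\<close>

text \<open>
  The component along \<open>p\<close> of minus the gradient of the interaction energy, up to the factor
  \<open>s / 2\<close>. For \<open>p = cos\<^sup>2\<close> and \<open>q = sin\<^sup>2\<close>, \<open>force N s p q (a\<^sup>2) (b\<^sup>2)\<close> is the coefficient \<open>A\<close> of
  the flow, and \<open>B\<close> arises by exchanging the roles of the two axes.
\<close>

definition force :: "real measure \<Rightarrow> real \<Rightarrow> (real \<Rightarrow> real) \<Rightarrow> (real \<Rightarrow> real) \<Rightarrow> real \<Rightarrow> real \<Rightarrow> real" where
  "force N s p q u v = (\<integral>x. (u * p x + v * q x) powr (- (2 + s) / 2) * p x \<partial>N)"

definition free_energy :: "real measure \<Rightarrow> real \<Rightarrow> (real \<Rightarrow> real) \<Rightarrow> (real \<Rightarrow> real) \<Rightarrow> real \<Rightarrow> real \<Rightarrow> real" where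
  "free_energy N s p q u v = (\<integral>x. (u * p x + v * q x) powr (- s / 2) \<partial>N) + s / 2 * (u + v)"

text \<open>
  An abstract version of a measure on the circle together with the functions \<open>cos\<^sup>2\<close> and
  \<open>sin\<^sup>2\<close>. It is symmetric in the two axes, so that each fact about \<open>A\<close> is also one about \<open>B\<close>.
  The points \<open>xp\<close> and \<open>xq\<close> are directions of the two axes, at which the other weight vanishes
  quadratically; the mass near them, at least proportional to length, makes the energy strongly
  convex on bounded sets and lets each force blow up as its own variable tends to \<open>0\<close>.
\<close>

locale planar_weight = finite_measure N for N :: "real measure" +
  fixes s c :: real and p q :: "real \<Rightarrow> real" and xp xq :: real
  assumes sets_N [measurable_cong]: "sets N = sets borel"
    and p_measurable [measurable]: "p \<in> borel_measurable borel"
    and q_measurable [measurable]: "q \<in> borel_measurable borel"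
    and p_nonneg: "\<And>x. 0 \<le> p x" and q_nonneg: "\<And>x. 0 \<le> q x"
    and p_plus_q: "\<And>x. p x + q x = 1"
    and s_pos: "0 < s" and c_pos: "0 < c"
    and q_small: "\<And>x. q x \<le> (x - xp)\<^sup>2" and p_small: "\<And>x. p x \<le> (x - xq)\<^sup>2"
    and mass_xp: "\<And>d. 0 \<le> d \<Longrightarrow> d \<le> 1 \<Longrightarrow> c * d \<le> measure N {xp - d..xp + d}"
    and mass_xq: "\<And>d. 0 \<le> d \<Longrightarrow> d \<le> 1 \<Longrightarrow> c * d \<le> measure N {xq - d..xq + d}"
begin

abbreviation "A u v \<equiv> force N s p q u v"
abbreviation "B u v \<equiv> force N s q p v u"
abbreviation "E u v \<equiv> free_energy N s p q u v"

lemma planar_weight_swap: "planar_weight N s c q p xq xp"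
proof -
  have "q x + p x = 1" for x using p_plus_q[of x] by simp
  thus ?thesis
    using sets_N p_measurable q_measurable p_nonneg q_nonneg s_pos c_pos
      q_small p_small mass_xp mass_xq
    by unfold_locales
qed

lemma free_energy_swap: "free_energy N s q p v u = E u v"
  unfolding free_energy_def by (simp add: add.commute)

lemma weighted_mean_ge: "m \<le> u \<Longrightarrow> m \<le> v \<Longrightarrow> m \<le> u * p x + v * q x"
proof -
  assume "m \<le> u" "m \<le> v"
  hence "m * p x + m * q x \<le> u * p x + v * q x"
    using p_nonneg q_nonneg by (intro add_mono mult_right_mono) auto
  moreover have "m * p x + m * q x = m" using p_plus_q[of x] by (simp flip: distrib_left)
  ultimately show ?thesis by simp
qed

lemma weighted_mean_le: "u \<le> M \<Longrightarrow> v \<le> M \<Longrightarrow> u * p x + v * q x \<le> M"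
proof -
  assume "u \<le> M" "v \<le> M"
  hence "u * p x + v * q x \<le> M * p x + M * q x"
    using p_nonneg q_nonneg by (intro add_mono mult_right_mono) auto
  moreover have "M * p x + M * q x = M" using p_plus_q[of x] by (simp flip: distrib_left)
  ultimately show ?thesis by simp
qed

lemma weighted_mean_pos: "0 < u \<Longrightarrow> 0 < v \<Longrightarrow> 0 < u * p x + v * q x"
proof -
  assume "0 < u" "0 < v"
  hence "0 < min u v" by simp
  also have "\<dots> \<le> u * p x + v * q x" by (rule weighted_mean_ge) auto
  finally show ?thesis .
qed

lemma p_le_1: "p x \<le> 1" and q_le_1: "q x \<le> 1"
  using p_plus_q[of x] p_nonneg[of x] q_nonneg[of x] by auto

lemma integrable_bounded:
  fixes f :: "real \<Rightarrow> real"
  assumes "f \<in> borel_measurable borel" "\<And>x. \<bar>f x\<bar> \<le> C"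
  shows "integrable N f"
  by (rule integrable_const_bound[of _ C])
    (use assms in \<open>simp_all add: measurable_cong_sets[OF sets_N refl]\<close>)

lemma powr_mean_bound:
  assumes "0 < m" "m \<le> u" "m \<le> v" "e \<le> 0"
  shows "(u * p x + v * q x) powr e \<le> m powr e"
  by (rule powr_mono2') (use assms weighted_mean_ge[of m u v x] in auto)

lemma integrable_powr_mean:
  assumes "0 < u" "0 < v" "e \<le> 0" "g \<in> borel_measurable borel" "\<And>x. \<bar>g x\<bar> \<le> C"
  shows "integrable N (\<lambda>x. (u * p x + v * q x) powr e * g x)"
proof (rule integrable_bounded)
  show "\<bar>(u * p x + v * q x) powr e * g x\<bar> \<le> min u v powr e * C" for x
    unfolding abs_mult by (rule mult_mono) (use assms powr_mean_bound[of "min u v" u v e x] in auto)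
qed (use assms in measurable)

lemma integrable_force:
  assumes "0 < u" "0 < v"
  shows "integrable N (\<lambda>x. (u * p x + v * q x) powr (- (2 + s) / 2) * p x)"
  by (rule integrable_powr_mean[where C = 1]) (use assms s_pos p_nonneg p_le_1 in auto)

lemma integrable_energy:
  assumes "0 < u" "0 < v"
  shows "integrable N (\<lambda>x. (u * p x + v * q x) powr (- s / 2))"
  using integrable_powr_mean[of u v "- s / 2" "\<lambda>x. 1" 1] assms s_pos by simp

lemma force_nonneg: "0 \<le> A u v"
  unfolding force_def by (intro integral_nonneg_AE AE_I2) (use p_nonneg in auto)

lemma force_bound:
  assumes "0 < m" "m \<le> u" "m \<le> v"
  shows "A u v \<le> m powr (- (2 + s) / 2) * measure N (space N)"
proof -
  have "A u v \<le> (\<integral>x. m powr (- (2 + s) / 2) \<partial>N)"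
    unfolding force_def
  proof (rule integral_mono)
    show "(u * p x + v * q x) powr (- (2 + s) / 2) * p x \<le> m powr (- (2 + s) / 2)" for x
      using mult_mono[OF powr_mean_bound[of m u v "- (2 + s) / 2" x] p_le_1[of x]] assms s_pos p_nonneg
      by auto
  qed (use integrable_force assms in auto)
  thus ?thesis by (simp add: mult.commute)
qed

lemma force_antimono:
  assumes "0 < u" "0 < v" "u \<le> u'" "v \<le> v'"
  shows "A u' v' \<le> A u v"
  unfolding force_def
proof (rule integral_mono)
  show "(u' * p x + v' * q x) powr (- (2 + s) / 2) * p x
        \<le> (u * p x + v * q x) powr (- (2 + s) / 2) * p x" for x
    using assms s_pos p_nonneg[of x] q_nonneg[of x] weighted_mean_pos[of u v x]
    by (intro mult_right_mono powr_mono2' add_mono) auto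
qed (use assms integrable_force in auto)

text \<open>
  Scaling both arguments by \<open>l\<close> multiplies the force by a power of \<open>l\<close>, and scaling one
  argument decreases the force less. This serves as a one-sided continuity of the force.
\<close>

lemma force_scale:
  assumes "0 < u" "0 < v" "1 \<le> l"
  shows "A u v \<le> l powr ((2 + s) / 2) * A (l * u) v"
proof -
  have "(l * u * p x + l * v * q x) powr (- (2 + s) / 2) * p x
      = l powr (- (2 + s) / 2) * ((u * p x + v * q x) powr (- (2 + s) / 2) * p x)" for x
  proof -
    have "l * u * p x + l * v * q x = l * (u * p x + v * q x)" by (simp add: algebra_simps)
    thus ?thesis using weighted_mean_pos[of u v x] assms by (simp add: powr_mult)
  qed
  hence "A (l * u) (l * v) = l powr (- (2 + s) / 2) * A u v"
    unfolding force_def by (simp only: integral_mult_right_zero)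
  moreover have "A (l * u) (l * v) \<le> A (l * u) v"
    by (rule force_antimono) (use assms in auto)
  moreover have "- (2 + s) / 2 = - ((2 + s) / 2)" by (simp only: minus_divide_left)
  ultimately have "inverse (l powr ((2 + s) / 2)) * A u v \<le> A (l * u) v"
    by (simp only: powr_minus)
  moreover have "0 < l powr ((2 + s) / 2)" using assms by simp
  ultimately show ?thesis by (simp add: field_simps)
qed

lemma force_sum:
  assumes "0 < u" "0 < v"
  shows "A u v * d + B u v * e = (\<integral>x. (u * p x + v * q x) powr (- (2 + s) / 2) * (d * p x + e * q x) \<partial>N)"
proof -
  interpret sw: planar_weight N s c q p xq xp by (rule planar_weight_swap)
  have i: "integrable N (\<lambda>x. (u * p x + v * q x) powr (- (2 + s) / 2) * p x)"
    by (rule integrable_force[OF assms])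
  have j: "integrable N (\<lambda>x. (u * p x + v * q x) powr (- (2 + s) / 2) * q x)"
    using sw.integrable_force[OF assms(2,1)] by (simp add: add.commute)
  have B: "B u v = (\<integral>x. (u * p x + v * q x) powr (- (2 + s) / 2) * q x \<partial>N)"
    unfolding force_def by (simp only: add.commute)
  have "A u v * d + B u v * e =
    (\<integral>x. (u * p x + v * q x) powr (- (2 + s) / 2) * p x * d + (u * p x + v * q x) powr (- (2 + s) / 2) * q x * e \<partial>N)"
    unfolding B unfolding force_def
    using i j by (simp only: Bochner_Integration.integral_add integrable_mult_left integral_mult_left_zero)
  also have "\<dots> = (\<integral>x. (u * p x + v * q x) powr (- (2 + s) / 2) * (d * p x + e * q x) \<partial>N)"
    by (rule Bochner_Integration.integral_cong) (simp_all add: distrib_left)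
  finally show ?thesis .
qed

text \<open>
  The energy lies above its tangent planes, whose slopes are given by the forces. This replaces
  differentiation under the integral sign.
\<close>

lemma free_energy_tangent:
  assumes "0 < u" "0 < v" "0 < u'" "0 < v'"
  shows "E u v - E u' v' \<le> s / 2 * ((1 - A u v) * (u - u') + (1 - B u v) * (v - v'))"
proof -
  have e: "- (s / 2) - 1 = - (2 + s) / 2" by (simp add: field_simps)
  have "(\<integral>x. (u * p x + v * q x) powr (- s / 2) \<partial>N) - (\<integral>x. (u' * p x + v' * q x) powr (- s / 2) \<partial>N)
     = (\<integral>x. (u * p x + v * q x) powr (- s / 2) - (u' * p x + v' * q x) powr (- s / 2) \<partial>N)"
    using integrable_energy assms by simp
  also have "\<dots> \<le> (\<integral>x. - (s / 2) * ((u * p x + v * q x) powr (- (2 + s) / 2) * ((u - u') * p x + (v - v') * q x)) \<partial>N)"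
  proof (rule integral_mono)
    have "\<bar>(u - u') * p x + (v - v') * q x\<bar> \<le> \<bar>u - u'\<bar> + \<bar>v - v'\<bar>" for x
    proof -
      have "\<bar>(u - u') * p x + (v - v') * q x\<bar> \<le> \<bar>u - u'\<bar> * p x + \<bar>v - v'\<bar> * q x"
        using abs_triangle_ineq[of "(u - u') * p x" "(v - v') * q x"] p_nonneg[of x] q_nonneg[of x]
        by (simp add: abs_mult)
      also have "\<dots> \<le> \<bar>u - u'\<bar> * 1 + \<bar>v - v'\<bar> * 1"
        using p_le_1 q_le_1 by (intro add_mono mult_left_mono) auto
      finally show ?thesis by simp
    qed
    thus "integrable N (\<lambda>x. - (s / 2) * ((u * p x + v * q x) powr (- (2 + s) / 2) * ((u - u') * p x + (v - v') * q x)))"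
      using assms s_pos by (intro integrable_mult_right integrable_powr_mean[where C = "\<bar>u - u'\<bar> + \<bar>v - v'\<bar>"]) auto
    show "(u * p x + v * q x) powr (- s / 2) - (u' * p x + v' * q x) powr (- s / 2) \<le>
      - (s / 2) * ((u * p x + v * q x) powr (- (2 + s) / 2) * ((u - u') * p x + (v - v') * q x))" for x
      using powr_neg_tangent[of "u * p x + v * q x" "u' * p x + v' * q x" "s / 2"]
        weighted_mean_pos assms s_pos unfolding e by (simp add: algebra_simps)
  qed (use integrable_energy assms in auto)
  also have "\<dots> = - (s / 2) * (A u v * (u - u') + B u v * (v - v'))"
    unfolding force_sum[OF assms(1,2)] by simp
  finally have "(\<integral>x. (u * p x + v * q x) powr (- s / 2) \<partial>N) - (\<integral>x. (u' * p x + v' * q x) powr (- s / 2) \<partial>N)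
    \<le> - (s / 2) * (A u v * (u - u') + B u v * (v - v'))" .
  moreover have "s / 2 * ((1 - A u v) * (u - u') + (1 - B u v) * (v - v'))
    = - (s / 2) * (A u v * (u - u') + B u v * (v - v')) + (s / 2 * (u + v) - s / 2 * (u' + v'))"
    by (simp add: field_simps)
  ultimately show ?thesis unfolding free_energy_def by linarith
qed

text \<open>
  Near the axis of \<open>p\<close> the weight \<open>p\<close> dominates \<open>q\<close>, so the larger coefficient
  cannot be cancelled by the smaller one there.
\<close>

lemma square_integral_ge_aux:
  assumes "\<bar>e\<bar> \<le> \<bar>d\<bar>"
  shows "c / 16 * (d\<^sup>2 + e\<^sup>2) \<le> (\<integral>x. (d * p x + e * q x)\<^sup>2 \<partial>N)"
proof -
  let ?I = "{xp - 1 / 2..xp + 1 / 2}"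
  have e2: "e\<^sup>2 \<le> d\<^sup>2" using assms by (simp add: abs_le_square_iff)
  have "c / 16 * (d\<^sup>2 + e\<^sup>2) \<le> c / 16 * (d\<^sup>2 + d\<^sup>2)"
    using e2 c_pos by (intro mult_left_mono) auto
  also have "\<dots> = d\<^sup>2 / 4 * (c * (1 / 2))" by simp
  also have "\<dots> \<le> d\<^sup>2 / 4 * measure N ?I"
    by (intro mult_left_mono mass_xp) auto
  also have "\<dots> = (\<integral>x. d\<^sup>2 / 4 * indicator ?I x \<partial>N)"
    using sets_eq_imp_space_eq[OF sets_N] by simp
  also have "\<dots> \<le> (\<integral>x. (d * p x + e * q x)\<^sup>2 \<partial>N)"
  proof (rule integral_mono)
    show "integrable N (\<lambda>x. d\<^sup>2 / 4 * indicator ?I x :: real)"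
      by (rule integrable_bounded[of _ "d\<^sup>2 / 4"]) (auto simp: indicator_def)
    have bd: "\<bar>d * p x + e * q x\<bar> \<le> \<bar>d\<bar>" for x
    proof -
      have "- \<bar>d\<bar> \<le> d * p x + e * q x" by (rule weighted_mean_ge) (use assms in auto)
      moreover have "d * p x + e * q x \<le> \<bar>d\<bar>" by (rule weighted_mean_le) (use assms in auto)
      ultimately show ?thesis by linarith
    qed
    show "integrable N (\<lambda>x. (d * p x + e * q x)\<^sup>2)"
      by (rule integrable_bounded[of _ "d\<^sup>2"]) (use bd in \<open>auto simp: abs_le_square_iff\<close>)
    show "d\<^sup>2 / 4 * indicator ?I x \<le> (d * p x + e * q x)\<^sup>2" for x
    proof (cases "x \<in> ?I")
      case True
      have "\<bar>x - xp\<bar> \<le> \<bar>1 / 2\<bar>" unfolding abs_le_iff using True by auto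
      hence "(x - xp)\<^sup>2 \<le> (1 / 2)\<^sup>2" by (simp only: abs_le_square_iff)
      hence q: "q x \<le> 1 / 4" "3 / 4 \<le> p x"
        using q_small[of x] p_plus_q[of x] by (auto simp: power2_eq_square)
      have "\<bar>d\<bar> * (1 / 2) \<le> \<bar>d\<bar> * (p x - q x)" using q by (intro mult_left_mono) auto
      also have "\<dots> \<le> \<bar>d\<bar> * p x - \<bar>e\<bar> * q x"
        using mult_right_mono[OF assms q_nonneg[of x]] by (simp add: algebra_simps)
      also have "\<dots> = \<bar>d * p x\<bar> - \<bar>e * q x\<bar>" using p_nonneg q_nonneg by (simp add: abs_mult)
      also have "\<dots> \<le> \<bar>d * p x + e * q x\<bar>" by linarith
      finally have "\<bar>d / 2\<bar> \<le> \<bar>d * p x + e * q x\<bar>" by simp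
      hence "(d / 2)\<^sup>2 \<le> (d * p x + e * q x)\<^sup>2" by (simp only: abs_le_square_iff)
      thus ?thesis using True by (simp add: power_divide)
    qed simp
  qed
  finally show ?thesis .
qed

lemma square_integral_ge:
  "c / 16 * (d\<^sup>2 + e\<^sup>2) \<le> (\<integral>x. (d * p x + e * q x)\<^sup>2 \<partial>N)"
proof (cases "\<bar>e\<bar> \<le> \<bar>d\<bar>")
  case False
  interpret sw: planar_weight N s c q p xq xp by (rule planar_weight_swap)
  show ?thesis using sw.square_integral_ge_aux[of d e] False by (simp add: add.commute)
qed (rule square_integral_ge_aux)

text \<open>
  With \<open>x = u p + v q\<close>, the left-hand side is the integral of
  \<open>(g x - g x') (x - x')\<close> for the decreasing function \<open>g x = x powr (- (2 + s) / 2)\<close>.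
  Hence it is at most a negative multiple of the integral of \<open>(x - x')\<^sup>2\<close>, which is a positive
  definite quadratic form by \<open>square_integral_ge\<close>.
\<close>

lemma force_strongly_monotone:
  assumes "0 < u" "u \<le> M" "0 < v" "v \<le> M" "0 < u'" "u' \<le> M" "0 < v'" "v' \<le> M"
  shows "(A u v - A u' v') * (u - u') + (B u v - B u' v') * (v - v')
     \<le> - ((2 + s) / 2 * M powr (- (2 + s) / 2 - 1) * (c / 16)) * ((u - u')\<^sup>2 + (v - v')\<^sup>2)"
proof -
  let ?X = "\<lambda>x. u * p x + v * q x" and ?Y = "\<lambda>x. u' * p x + v' * q x"
  let ?D = "\<lambda>x. (u - u') * p x + (v - v') * q x"
  let ?k = "(2 + s) / 2" let ?K = "?k * M powr (- (2 + s) / 2 - 1)"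
  have D: "\<bar>?D x\<bar> \<le> M" for x
  proof -
    have "- M \<le> u - u'" "- M \<le> v - v'" "u - u' \<le> M" "v - v' \<le> M" using assms by auto
    thus ?thesis using weighted_mean_ge[of "-M" "u - u'" "v - v'" x] weighted_mean_le[of "u - u'" M "v - v'" x] by auto
  qed
  have M: "0 < M" using assms by linarith
  have i1: "integrable N (\<lambda>x. ?X x powr (- (2 + s) / 2) * ?D x)"
    and i2: "integrable N (\<lambda>x. ?Y x powr (- (2 + s) / 2) * ?D x)"
    using assms s_pos D by (auto intro!: integrable_powr_mean[where C = M])
  have i3: "integrable N (\<lambda>x. (?D x)\<^sup>2)"
    by (rule integrable_bounded[of _ "M\<^sup>2"]) (use D M in \<open>auto intro!: abs_le_square_iff[THEN iffD1]\<close>)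
  have "(A u v - A u' v') * (u - u') + (B u v - B u' v') * (v - v')
    = (A u v * (u - u') + B u v * (v - v')) - (A u' v' * (u - u') + B u' v' * (v - v'))"
    by (simp add: algebra_simps)
  also have "\<dots> = (\<integral>x. ?X x powr (- (2 + s) / 2) * ?D x - ?Y x powr (- (2 + s) / 2) * ?D x \<partial>N)"
    using i1 i2 assms by (simp add: force_sum)
  also have "\<dots> \<le> (\<integral>x. - ?K * (?D x)\<^sup>2 \<partial>N)"
  proof (rule integral_mono)
    show "?X x powr (- (2 + s) / 2) * ?D x - ?Y x powr (- (2 + s) / 2) * ?D x \<le> - ?K * (?D x)\<^sup>2" for x
    proof -
      have D: "?X x - ?Y x = ?D x" by (simp add: algebra_simps)
      have e: "- ((2 + s) / 2) = - (2 + s) / 2" by (simp only: minus_divide_left)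
      have "(?X x powr (- ?k) - ?Y x powr (- ?k)) * (?X x - ?Y x) \<le> - (?k * M powr (- ?k - 1)) * (?X x - ?Y x)\<^sup>2"
        using assms s_pos by (intro powr_neg_strongly_decreasing weighted_mean_pos weighted_mean_le) auto
      thus ?thesis unfolding D e by (simp only: left_diff_distrib)
    qed
    show "integrable N (\<lambda>x. - ?K * (?D x)\<^sup>2)" using i3 by (rule integrable_mult_right)
    show "integrable N (\<lambda>x. ?X x powr (- (2 + s) / 2) * ?D x - ?Y x powr (- (2 + s) / 2) * ?D x)"
      using i1 i2 by (rule Bochner_Integration.integrable_diff)
  qed
  also have "\<dots> = - (?K * (\<integral>x. (?D x)\<^sup>2 \<partial>N))" by simp
  also have "\<dots> \<le> - (?K * (c / 16 * ((u - u')\<^sup>2 + (v - v')\<^sup>2)))"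
    using s_pos M by (intro le_imp_neg_le mult_left_mono square_integral_ge) auto
  finally show ?thesis by (simp only: mult.assoc minus_mult_left)
qed

text \<open>
  For \<open>u = m\<close> the angles within \<open>sqrt (m / M)\<close> of the axis satisfy \<open>m p + M q \<le> 2 m\<close>, so
  they contribute at least a multiple of \<open>m powr (- (2 + s) / 2 + 1 / 2)\<close> to the force; this
  tends to infinity as \<open>m\<close> tends to \<open>0\<close>.
\<close>

lemma force_gt_1_near_axis:
  assumes M: "0 < M"
  shows "\<exists>m>0. 1 < A m M"
proof -
  \<comment> \<open>\<open>m \<le> 1 / 2\<close> lets \<open>(2 m) powr (-1)\<close> replace the larger \<open>(2 m) powr (- (2 + s) / 2)\<close>, \<open>m \<le> M / 2\<close>
    gives \<open>p \<ge> 1 / 2\<close> on the interval, and the last bound makes \<open>c / (4 sqrt (m M))\<close> exceed \<open>1\<close>.\<close>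
  define m where "m = min (min (1 / 2) (M / 2)) (c\<^sup>2 / (32 * M))"
  define d where "d = sqrt (m / M)"
  have m: "0 < m" "m \<le> 1 / 2" "m \<le> M / 2" "m * M \<le> c\<^sup>2 / 32"
  proof -
    show "0 < m" using M c_pos by (simp add: m_def)
    have "m \<le> c\<^sup>2 / (32 * M)" by (simp add: m_def)
    thus "m * M \<le> c\<^sup>2 / 32" using M by (simp add: field_simps)
  qed (auto simp: m_def)
  have d2: "d\<^sup>2 = m / M" using m M by (simp add: d_def)
  have d: "0 < d" "d \<le> 1" using m M by (auto simp: d_def)
  let ?I = "{xp - d..xp + d}"
  have "c / (4 * sqrt (m * M)) = 1 / (2 * m) * (1 / 2) * (c * d)"
  proof -
    have "sqrt (m * M) = d * M" using M m unfolding d_def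
      by (simp add: real_sqrt_mult real_sqrt_divide field_simps)
    moreover have "m = d\<^sup>2 * M" using d2 M by simp
    ultimately show ?thesis using d M by (simp add: field_simps power2_eq_square)
  qed
  moreover have "1 < c / (4 * sqrt (m * M))"
  proof -
    have "sqrt (m * M) < sqrt ((c / 4)\<^sup>2)"
    proof (rule real_sqrt_less_mono)
      have "c\<^sup>2 / 32 < c\<^sup>2 / 16" using c_pos by simp
      also have "\<dots> = (c / 4)\<^sup>2" by (simp add: power_divide)
      finally show "m * M < (c / 4)\<^sup>2" using m(4) by linarith
    qed
    hence "4 * sqrt (m * M) < c" using c_pos by simp
    moreover have "0 < sqrt (m * M)" using m M by simp
    ultimately show ?thesis by simp
  qed
  ultimately have "1 < 1 / (2 * m) * (1 / 2) * (c * d)" by simp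
  also have "\<dots> \<le> 1 / (2 * m) * (1 / 2) * measure N ?I"
    using m d by (intro mult_left_mono mass_xp) auto
  also have "\<dots> = (\<integral>x. 1 / (2 * m) * (1 / 2) * indicator ?I x \<partial>N)"
    using sets_eq_imp_space_eq[OF sets_N] by simp
  also have "\<dots> \<le> A m M" unfolding force_def
  proof (rule integral_mono)
    show "integrable N (\<lambda>x. 1 / (2 * m) * (1 / 2) * indicator ?I x :: real)"
      by (rule integrable_bounded[of _ "1 / (2 * m) * (1 / 2)"]) (use m in \<open>auto simp: indicator_def\<close>)
    show "integrable N (\<lambda>x. (m * p x + M * q x) powr (- (2 + s) / 2) * p x)"
      by (rule integrable_force) (use m M in auto)
    show "1 / (2 * m) * (1 / 2) * indicator ?I x \<le> (m * p x + M * q x) powr (- (2 + s) / 2) * p x" for x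
    proof (cases "x \<in> ?I")
      case True
      have "(x - xp)\<^sup>2 \<le> d\<^sup>2" using True by (intro abs_le_square_iff[THEN iffD1]) auto
      hence q: "q x \<le> m / M" using q_small[of x] d2 by simp
      hence "q x \<le> 1 / 2" using order_trans[OF q, of "1 / 2"] m M by (simp add: field_simps)
      hence p: "1 / 2 \<le> p x" using p_plus_q[of x] by simp
      have "m * p x + M * q x \<le> m * 1 + M * (m / M)"
        using q m M p_le_1 by (intro add_mono mult_left_mono) auto
      hence X: "m * p x + M * q x \<le> 2 * m" using M by simp
      have "1 / (2 * m) = (2 * m) powr (- 1)" using m by (simp add: powr_minus_divide)
      also have "\<dots> \<le> (2 * m) powr (- (2 + s) / 2)"
        using m s_pos by (intro powr_mono') (auto simp: field_simps)
      also have "\<dots> \<le> (m * p x + M * q x) powr (- (2 + s) / 2)"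
        using X m M s_pos weighted_mean_pos[of m M x] by (intro powr_mono2') auto
      finally have "1 / (2 * m) * (1 / 2) \<le> (m * p x + M * q x) powr (- (2 + s) / 2) * p x"
        using p m by (intro mult_mono) auto
      thus ?thesis using True by simp
    qed (use p_nonneg in auto)
  qed
  finally show ?thesis using m by blast
qed

section \<open>Existence and uniqueness of the equilibrium\<close>

text \<open>
  By the tangent inequality the forces bound the slope of the energy, and they are bounded away
  from the axes. The constant depends only on \<open>m\<close>.
\<close>

lemma free_energy_lipschitz:
  assumes "0 < m" "m \<le> u" "m \<le> v" "m \<le> u'" "m \<le> v'"
  shows "E u v - E u' v'
     \<le> s / 2 * (1 + m powr (- (2 + s) / 2) * measure N (space N)) * (\<bar>u - u'\<bar> + \<bar>v - v'\<bar>)"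
proof -
  let ?W = "m powr (- (2 + s) / 2) * measure N (space N)"
  interpret sw: planar_weight N s c q p xq xp by (rule planar_weight_swap)
  have AB: "\<bar>1 - A u v\<bar> \<le> 1 + ?W" "\<bar>1 - B u v\<bar> \<le> 1 + ?W"
    using force_bound[of m u v] sw.force_bound[of m v u] force_nonneg[of u v]
      sw.force_nonneg[of v u] assms by auto
  have "(1 - A u v) * (u - u') \<le> (1 + ?W) * \<bar>u - u'\<bar>"
    by (rule order_trans[OF abs_ge_self]) (use AB in \<open>auto simp: abs_mult intro: mult_right_mono\<close>)
  moreover have "(1 - B u v) * (v - v') \<le> (1 + ?W) * \<bar>v - v'\<bar>"
    by (rule order_trans[OF abs_ge_self]) (use AB in \<open>auto simp: abs_mult intro: mult_right_mono\<close>)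
  ultimately have "s / 2 * ((1 - A u v) * (u - u') + (1 - B u v) * (v - v'))
    \<le> s / 2 * ((1 + ?W) * \<bar>u - u'\<bar> + (1 + ?W) * \<bar>v - v'\<bar>)"
    using s_pos by (intro mult_left_mono) auto
  also have "\<dots> = s / 2 * (1 + ?W) * (\<bar>u - u'\<bar> + \<bar>v - v'\<bar>)"
    by (simp add: algebra_simps)
  finally show ?thesis using free_energy_tangent[of u v u' v'] assms by linarith
qed

lemma free_energy_continuous:
  assumes "0 < m"
  shows "continuous_on ({m..M} \<times> {m..M}) (\<lambda>z. E (fst z) (snd z))"
proof -
  define K where "K = s / 2 * (1 + m powr (- (2 + s) / 2) * measure N (space N))"
  have K: "0 \<le> K" using s_pos by (auto simp: K_def)
  have *: "E (fst x) (snd x) - E (fst y) (snd y) \<le> 2 * K * dist x y"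
    if "x \<in> {m..M} \<times> {m..M}" "y \<in> {m..M} \<times> {m..M}" for x y :: "real \<times> real"
  proof -
    have "E (fst x) (snd x) - E (fst y) (snd y) \<le> K * (\<bar>fst x - fst y\<bar> + \<bar>snd x - snd y\<bar>)"
      unfolding K_def by (rule free_energy_lipschitz) (use that assms in auto)
    also have "\<dots> \<le> K * (dist x y + dist x y)"
      using K dist_fst_le[of x y] dist_snd_le[of x y]
      by (intro mult_left_mono add_mono) (auto simp: dist_real_def)
    finally show ?thesis by simp
  qed
  have "(2 * K)-lipschitz_on ({m..M} \<times> {m..M}) (\<lambda>z. E (fst z) (snd z))"
  proof (rule lipschitz_onI)
    fix x y :: "real \<times> real" assume "x \<in> {m..M} \<times> {m..M}" "y \<in> {m..M} \<times> {m..M}"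
    thus "dist (E (fst x) (snd x)) (E (fst y) (snd y)) \<le> 2 * K * dist x y"
      using *[of x y] *[of y x] by (simp add: dist_real_def dist_commute abs_le_iff)
  qed (use K in simp)
  thus ?thesis by (rule lipschitz_on_continuous_on)
qed

text \<open>
  The first-order condition at a minimum that can be approached from the right. The tangent
  inequality gives it at the nearby points \<open>l u\<close>, and \<open>force_scale\<close> carries it over to \<open>u\<close>
  as \<open>l\<close> tends to \<open>1\<close>.
\<close>

lemma force_le_1_at_min:
  assumes "0 < u" "u < M" "0 < v" "\<And>u'. u < u' \<Longrightarrow> u' \<le> M \<Longrightarrow> E u v \<le> E u' v"
  shows "A u v \<le> 1"
proof (rule tendsto_lowerbound[OF powr_tendsto_1[of "(2 + s) / 2"]])
  have "\<forall>\<^sub>F l in at_right 1. l \<in> {1<..<M / u}"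
    by (rule eventually_at_right_real) (use assms in \<open>simp add: field_simps\<close>)
  thus "\<forall>\<^sub>F l in at_right 1. A u v \<le> l powr ((2 + s) / 2)"
  proof eventually_elim
    case (elim l)
    hence l: "1 < l" "u < l * u" "l * u \<le> M" using assms by (auto simp: field_simps)
    have "0 \<le> s / 2 * ((1 - A (l * u) v) * (l * u - u))"
      using free_energy_tangent[of "l * u" v u v] assms(4)[of "l * u"] l assms(1,3) by auto
    hence "A (l * u) v \<le> 1" using l s_pos assms by (simp add: zero_le_mult_iff)
    hence "l powr ((2 + s) / 2) * A (l * u) v \<le> l powr ((2 + s) / 2) * 1"
      by (intro mult_left_mono) auto
    with order_trans[OF force_scale[of u v l]] l assms show ?case by simp
  qed
qed simp

lemma force_ge_1_at_min:
  assumes "0 < m" "m < u" "0 < v" "\<And>u'. m \<le> u' \<Longrightarrow> u' < u \<Longrightarrow> E u v \<le> E u' v"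
  shows "1 \<le> A u v"
proof (rule tendsto_lowerbound)
  show "((\<lambda>l. l powr ((2 + s) / 2) * A u v) \<longlongrightarrow> A u v) (at_right 1)"
    by (auto intro!: tendsto_eq_intros)
  have "\<forall>\<^sub>F l in at_right 1. l \<in> {1<..<u / m}"
    by (rule eventually_at_right_real) (use assms in \<open>simp add: field_simps\<close>)
  thus "\<forall>\<^sub>F l in at_right 1. 1 \<le> l powr ((2 + s) / 2) * A u v"
  proof eventually_elim
    case (elim l)
    hence l: "1 < l" "u / l < u" "m \<le> u / l" using assms by (auto simp: field_simps)
    have "0 \<le> s / 2 * ((1 - A (u / l) v) * (u / l - u))"
      using free_energy_tangent[of "u / l" v u v] assms(4)[of "u / l"] l assms(1-3) by auto
    hence "1 \<le> A (u / l) v" using l s_pos assms by (auto simp: zero_le_mult_iff)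
    with force_scale[of "u / l" v l] l assms show ?case by simp
  qed
qed simp

text \<open>
  The minimum of the energy over a square \<open>[m, M]\<^sup>2\<close> cannot lie on the boundary, so both
  one-sided first-order conditions hold at it.
\<close>

lemma equilibrium_exists:
  "\<exists>u>0. \<exists>v>0. A u v = 1 \<and> B u v = 1"
proof -
  interpret sw: planar_weight N s c q p xq xp by (rule planar_weight_swap)
  \<comment> \<open>Since \<open>E u v \<ge> s / 2 (u + v)\<close>, the energy exceeds \<open>E 1 1\<close> wherever \<open>u \<ge> M\<close> or \<open>v \<ge> M\<close>.\<close>
  define M where "M = max 1 (2 * E 1 1 / s) + 1"
  have M: "1 < M" "E 1 1 < s / 2 * M"
  proof -
    have "2 * E 1 1 / s < M" by (simp add: M_def)
    thus "E 1 1 < s / 2 * M" using s_pos by (simp add: field_simps)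
  qed (auto simp: M_def)
  obtain m1 m2 where m12: "0 < m1" "1 < A m1 M" "0 < m2" "1 < B M m2"
    using force_gt_1_near_axis[of M] sw.force_gt_1_near_axis[of M] M by force
  define m where "m = min 1 (min m1 m2)"
  have m: "0 < m" "m \<le> 1" "m \<le> m1" "m \<le> m2" using m12 by (auto simp: m_def)
  have "\<exists>z\<in>{m..M} \<times> {m..M}. \<forall>y\<in>{m..M} \<times> {m..M}. E (fst z) (snd z) \<le> E (fst y) (snd y)"
  proof (rule continuous_attains_inf)
    show "compact ({m..M} \<times> {m..M})" by (intro compact_Times) auto
    show "{m..M} \<times> {m..M} \<noteq> {}" using m M by auto
  qed (rule free_energy_continuous[OF m(1)])
  then obtain z where z: "z \<in> {m..M} \<times> {m..M}"
    "\<And>y. y \<in> {m..M} \<times> {m..M} \<Longrightarrow> E (fst z) (snd z) \<le> E (fst y) (snd y)"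
    by blast
  obtain u v where uv: "z = (u, v)" by (cases z)
  have box: "m \<le> u" "u \<le> M" "m \<le> v" "v \<le> M"
    and min: "\<And>u' v'. m \<le> u' \<Longrightarrow> u' \<le> M \<Longrightarrow> m \<le> v' \<Longrightarrow> v' \<le> M \<Longrightarrow> E u v \<le> E u' v'"
    using z uv by auto
  have pos: "0 < u" "0 < v" using box m by auto
  have "s / 2 * (u + v) \<le> E u v"
    unfolding free_energy_def by (simp add: integral_nonneg_AE)
  also have "\<dots> < s / 2 * M" using min[of 1 1] m M by linarith
  finally have lt: "u < M" "v < M" using s_pos pos by auto
  have A1: "A u v \<le> 1"
    by (rule force_le_1_at_min[of u M]) (use min box lt pos in auto)
  have B1: "B u v \<le> 1"
    by (rule sw.force_le_1_at_min[of v M]) (use min box lt pos in \<open>auto simp: free_energy_swap\<close>)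
  have "m \<noteq> u"
  proof
    assume "m = u"
    hence "A m1 M \<le> A u v" by (intro force_antimono) (use m box pos in auto)
    thus False using A1 m12 by simp
  qed
  hence "1 \<le> A u v"
    by (intro force_ge_1_at_min[of m u]) (use m min box lt pos in auto)
  moreover have "m \<noteq> v"
  proof
    assume "m = v"
    hence "B M m2 \<le> B u v" by (intro sw.force_antimono) (use m box pos in auto)
    thus False using B1 m12 by simp
  qed
  hence "1 \<le> B u v"
    by (intro sw.force_ge_1_at_min[of m v]) (use m min box lt pos in \<open>auto simp: free_energy_swap\<close>)
  ultimately show ?thesis using A1 B1 pos by (intro exI[of _ u] exI[of _ v] conjI) auto
qed

lemma monotonicity_at_equilibrium:
  assumes "A us vs = 1" "B us vs = 1" "0 < us" "us \<le> M" "0 < vs" "vs \<le> M"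
    "0 < u" "u \<le> M" "0 < v" "v \<le> M"
  shows "(A u v - 1) * (u - us) + (B u v - 1) * (v - vs)
     \<le> - ((2 + s) / 2 * M powr (- (2 + s) / 2 - 1) * (c / 16)) * ((u - us)\<^sup>2 + (v - vs)\<^sup>2)"
  using force_strongly_monotone[of u M v us vs] assms by simp

lemma monotonicity_constant_pos:
  "0 < M \<Longrightarrow> 0 < (2 + s) / 2 * M powr (- (2 + s) / 2 - 1) * (c / 16)"
  using s_pos c_pos by (intro mult_pos_pos) auto

lemma equilibrium_unique:
  assumes "A us vs = 1" "B us vs = 1" "0 < us" "0 < vs"
    and "A u v = 1" "B u v = 1" "0 < u" "0 < v"
  shows "u = us \<and> v = vs"
proof -
  define M where "M = max (max us vs) (max u v)"
  define K where "K = (2 + s) / 2 * M powr (- (2 + s) / 2 - 1) * (c / 16)"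
  have K: "0 < K" unfolding K_def
    by (rule monotonicity_constant_pos) (use assms in \<open>auto simp: M_def\<close>)
  have "(A u v - 1) * (u - us) + (B u v - 1) * (v - vs) \<le> - K * ((u - us)\<^sup>2 + (v - vs)\<^sup>2)"
    unfolding K_def by (rule monotonicity_at_equilibrium) (use assms in \<open>auto simp: M_def\<close>)
  hence "K * ((u - us)\<^sup>2 + (v - vs)\<^sup>2) \<le> 0" using assms by simp
  hence "(u - us)\<^sup>2 + (v - vs)\<^sup>2 \<le> 0" using K by (simp add: mult_le_0_iff)
  hence "(u - us)\<^sup>2 + (v - vs)\<^sup>2 = 0" by (smt (verit) zero_le_power2)
  thus ?thesis by (simp add: sum_power2_eq_zero_iff)
qed

end

section \<open>Exponential convergence of the flow\<close>

lemma nondecreasing_of_derivative_nonneg: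
  fixes f f' :: "real \<Rightarrow> real"
  assumes "\<And>t. 0 \<le> t \<Longrightarrow> (f has_real_derivative f' t) (at t within {0..})"
    and "\<And>t. 0 \<le> t \<Longrightarrow> 0 \<le> f' t" and "0 \<le> t"
  shows "f 0 \<le> f t"
proof (rule DERIV_nonneg_imp_increasing_open[OF \<open>0 \<le> t\<close>])
  fix x :: real assume "0 < x" "x < t"
  hence "at x within {0..} = at x" by (intro at_within_interior) simp
  thus "\<exists>y. (f has_real_derivative y) (at x) \<and> 0 \<le> y"
    using assms(1)[of x] assms(2)[of x] \<open>0 < x\<close> by auto
next
  have "continuous_on {0..} f"
    unfolding continuous_on_eq_continuous_within using assms(1) DERIV_continuous by blast
  thus "continuous_on {0..t} f" by (rule continuous_on_subset) auto
qed

text \<open>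
  A lower bound on the growth rate suffices: \<open>x\<^sup>2 exp (2 k t)\<close> is nondecreasing, so \<open>x\<close> has no
  zero and keeps its sign. For the flow this applies to \<open>a\<close> and \<open>b\<close> before anything is known about
  the orbit, as the forces are nonnegative at every point of the plane.
\<close>

lemma linear_flow_positive:
  fixes x g :: "real \<Rightarrow> real"
  assumes flow: "\<And>t. 0 \<le> t \<Longrightarrow> (x has_real_derivative g t * x t) (at t within {0..})"
    and g: "\<And>t. 0 \<le> t \<Longrightarrow> - k \<le> g t" and "0 < x 0" and t: "0 \<le> t"
  shows "0 < x t"
proof -
  have sq: "0 < (x t)\<^sup>2" if "0 \<le> t" for t
  proof -
    have "(x 0)\<^sup>2 * exp (2 * k * 0) \<le> (x t)\<^sup>2 * exp (2 * k * t)"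
    proof (rule nondecreasing_of_derivative_nonneg[where f' = "\<lambda>t. 2 * (g t + k) * (x t)\<^sup>2 * exp (2 * k * t)"])
      show "((\<lambda>t. (x t)\<^sup>2 * exp (2 * k * t)) has_real_derivative
        2 * (g t + k) * (x t)\<^sup>2 * exp (2 * k * t)) (at t within {0..})" if "0 \<le> t" for t
        by (auto intro!: derivative_eq_intros flow that simp: algebra_simps power2_eq_square)
      show "0 \<le> 2 * (g t + k) * (x t)\<^sup>2 * exp (2 * k * t)" if "0 \<le> t" for t
        using g[OF that] by (intro mult_nonneg_nonneg) auto
    qed (rule that)
    moreover have "0 < (x 0)\<^sup>2" using assms(3) by simp
    ultimately show ?thesis by (smt (verit) exp_gt_zero exp_zero mult_zero_right mult_cancel_left1 zero_less_mult_pos2)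
  qed
  have "continuous_on {0..} x"
    unfolding continuous_on_eq_continuous_within using flow DERIV_continuous by blast
  hence c: "continuous_on {0..t} x" by (rule continuous_on_subset) auto
  show ?thesis
  proof (rule ccontr)
    assume "\<not> 0 < x t"
    then obtain r where "0 \<le> r" "r \<le> t" "x r = 0"
      using IVT2'[of x t 0 0] c t \<open>0 < x 0\<close> by force
    thus False using sq[of r] by simp
  qed
qed

text \<open>
  The generalised Kullback-Leibler divergence \<open>w ln (w / u) - w + u\<close> of two positive masses.
\<close>

definition rel_entropy :: "real \<Rightarrow> real \<Rightarrow> real" where
  "rel_entropy w u = u - w - w * ln (u / w)"

text \<open>
  This is \<open>ln z \<le> z - 1\<close> at \<open>z = w / u\<close>.
\<close>

lemma rel_entropy_upper:
  assumes "0 < u" "0 < w"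
  shows "rel_entropy w u \<le> (u - w)\<^sup>2 / u"
proof -
  have "ln (w / u) \<le> w / u - 1" using assms by (intro ln_le_minus_one) simp
  hence "w * (- ln (u / w)) \<le> w * (w / u - 1)" using assms
    by (intro mult_left_mono) (auto simp: ln_div)
  moreover have "u - w + w * (w / u - 1) = (u - w)\<^sup>2 / u"
    using assms by (simp add: field_simps power2_eq_square)
  ultimately show ?thesis unfolding rel_entropy_def by simp
qed

text \<open>
  With \<open>x = sqrt (u / w)\<close>, the inequality \<open>ln x \<le> x - 1\<close> bounds the entropy below by
  \<open>w (x - 1)\<^sup>2\<close>. Applied to \<open>u / w\<close> itself instead of its root, that inequality would only give
  nonnegativity.
\<close>

lemma rel_entropy_lower:
  assumes "0 < u" "0 < w"
  shows "(u - w)\<^sup>2 / (2 * (u + w)) \<le> rel_entropy w u"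
proof -
  define x where "x = sqrt (u / w)"
  have x: "0 < x" "u = w * x\<^sup>2" using assms by (auto simp: x_def)
  have "ln (u / w) = 2 * ln x" unfolding x_def using assms by (simp add: ln_sqrt)
  moreover have "ln x \<le> x - 1" using x by (intro ln_le_minus_one)
  ultimately have "w * ln (u / w) \<le> w * (2 * (x - 1))" using assms by (intro mult_left_mono) auto
  hence 1: "w * (x - 1)\<^sup>2 \<le> rel_entropy w u"
    unfolding rel_entropy_def x(2) by (simp add: power2_eq_square algebra_simps)
  have "(x + 1)\<^sup>2 \<le> 2 * (x\<^sup>2 + 1)" using zero_le_power2[of "x - 1"] by (simp add: power2_eq_square algebra_simps)
  hence "(x + 1)\<^sup>2 / (2 * (x\<^sup>2 + 1)) \<le> 1" by (subst divide_le_eq_1_pos) (auto simp: add_nonneg_pos)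
  hence "w * (x - 1)\<^sup>2 * ((x + 1)\<^sup>2 / (2 * (x\<^sup>2 + 1))) \<le> w * (x - 1)\<^sup>2 * 1"
    using assms by (intro mult_left_mono) auto
  moreover have "w * (x - 1)\<^sup>2 * ((x + 1)\<^sup>2 / (2 * (x\<^sup>2 + 1))) = (u - w)\<^sup>2 / (2 * (u + w))"
  proof -
    have a: "x\<^sup>2 + 1 \<noteq> 0" by (smt (verit) zero_le_power2)
    have "u - w = w * ((x - 1) * (x + 1))" "u + w = w * (x\<^sup>2 + 1)"
      unfolding x(2) by (simp_all add: power2_eq_square algebra_simps)
    hence "(u - w)\<^sup>2 / (2 * (u + w)) = (w * ((x - 1) * (x + 1)))\<^sup>2 / (2 * (w * (x\<^sup>2 + 1)))" by simp
    also have "\<dots> = w * (x - 1)\<^sup>2 * ((x + 1)\<^sup>2 / (2 * (x\<^sup>2 + 1)))"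
      using assms a by (simp add: power_mult_distrib power2_eq_square[of w])
    finally show ?thesis by simp
  qed
  ultimately show ?thesis using 1 by simp
qed

lemma rel_entropy_nonneg: "0 < u \<Longrightarrow> 0 < w \<Longrightarrow> 0 \<le> rel_entropy w u"
  using rel_entropy_lower[of u w] by (smt (verit) divide_nonneg_pos zero_le_power2)

text \<open>
  Sublevel sets are compact in \<open>(0, \<infinity>)\<close>; this confines the orbits of the flow.
\<close>

lemma rel_entropy_sublevel:
  assumes "0 < u" "0 < w" "rel_entropy w u \<le> l"
  shows "w * exp (- (l / w + 1)) \<le> u" and "u \<le> 2 * (l + w)"
proof -
  have "- w - w * ln (u / w) \<le> l" using assms unfolding rel_entropy_def by simp
  hence "- (l / w + 1) \<le> ln (u / w)" using assms(2) by (simp add: field_simps)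
  hence "exp (- (l / w + 1)) \<le> u / w" using assms by (subst (asm) ln_ge_iff) auto
  thus "w * exp (- (l / w + 1)) \<le> u" using assms(2) by (simp add: field_simps)
  have "ln (u / w / 2) \<le> u / w / 2 - 1" using assms by (intro ln_le_minus_one) simp
  moreover have "ln (u / w / 2) = ln (u / w) - ln 2" by (rule ln_divide_pos) (use assms in auto)
  moreover have "ln 2 \<le> (1 :: real)" using ln_2_less_1 by simp
  ultimately have "ln (u / w) \<le> u / w / 2" by linarith
  hence "w * ln (u / w) \<le> w * (u / w / 2)" using assms by (intro mult_left_mono) auto
  thus "u \<le> 2 * (l + w)" using assms unfolding rel_entropy_def by simp
qed

text \<open>
  The factor \<open>u\<close> of the flow cancels against the derivative \<open>1 - w / u\<close> of the entropy.
\<close>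

lemma rel_entropy_derivative:
  assumes "(u has_real_derivative 4 * (f - 1) * u t) (at t within T)" "0 < u t" "0 < w"
  shows "((\<lambda>t. rel_entropy w (u t)) has_real_derivative 4 * ((f - 1) * (u t - w))) (at t within T)"
  unfolding rel_entropy_def
  by (rule derivative_eq_intros assms refl | use assms in \<open>simp add: field_simps; fail\<close>)+

context planar_weight
begin

text \<open>
  The sum \<open>L\<close> of the two relative entropies is a Lyapunov function. Its monotonicity confines the
  orbit to a square \<open>[m, M]\<^sup>2\<close>; only then are the strong monotonicity constant and the comparison
  of \<open>L\<close> with the squared distance uniform in time, and they give \<open>L' \<le> - k L\<close>.
\<close>

theorem flow_converges_exponentially:
  fixes u v :: "real \<Rightarrow> real"
  assumes eq: "A us vs = 1" "B us vs = 1" "0 < us" "0 < vs"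
    and pos: "\<And>t. 0 \<le> t \<Longrightarrow> 0 < u t" "\<And>t. 0 \<le> t \<Longrightarrow> 0 < v t"
    and du: "\<And>t. 0 \<le> t \<Longrightarrow> (u has_real_derivative 4 * (A (u t) (v t) - 1) * u t) (at t within {0..})"
    and dv: "\<And>t. 0 \<le> t \<Longrightarrow> (v has_real_derivative 4 * (B (u t) (v t) - 1) * v t) (at t within {0..})"
  shows "\<exists>C>0. \<exists>r>0. \<forall>t\<ge>0. \<bar>u t - us\<bar> + \<bar>v t - vs\<bar> \<le> C * exp (- r * t)
     \<and> E (u t) (v t) - E us vs \<le> C * exp (- r * t)"
proof -
  define L where "L t = rel_entropy us (u t) + rel_entropy vs (v t)" for t
  define L' where "L' t = 4 * ((A (u t) (v t) - 1) * (u t - us) + (B (u t) (v t) - 1) * (v t - vs))" for t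
  define D where "D t = (u t - us)\<^sup>2 + (v t - vs)\<^sup>2" for t
  have dL: "(L has_real_derivative L' t) (at t within {0..})" if t: "0 \<le> t" for t
  proof -
    have "((\<lambda>t. rel_entropy us (u t) + rel_entropy vs (v t)) has_real_derivative
      4 * ((A (u t) (v t) - 1) * (u t - us)) + 4 * ((B (u t) (v t) - 1) * (v t - vs))) (at t within {0..})"
      by (intro DERIV_add rel_entropy_derivative du dv pos t eq)
    thus ?thesis unfolding L_def[abs_def] L'_def by (simp add: distrib_left)
  qed
  have L'_nonpos: "L' t \<le> 0" if "0 \<le> t" for t
  proof -
    define M where "M = max (max us vs) (max (u t) (v t))"
    let ?K = "(2 + s) / 2 * M powr (- (2 + s) / 2 - 1) * (c / 16)"
    have "0 < ?K" by (rule monotonicity_constant_pos) (use eq in \<open>auto simp: M_def\<close>)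
    hence nonpos: "- ?K * D t \<le> 0" by (intro mult_nonpos_nonneg) (auto simp: D_def)
    have "(A (u t) (v t) - 1) * (u t - us) + (B (u t) (v t) - 1) * (v t - vs) \<le> - ?K * D t"
      unfolding D_def by (rule monotonicity_at_equilibrium) (use eq pos that in \<open>auto simp: M_def\<close>)
    from order_trans[OF this nonpos] show ?thesis
      unfolding L'_def by (intro mult_nonneg_nonpos) simp_all
  qed
  have L_le: "L t \<le> L 0" if "0 \<le> t" for t
  proof -
    have "- L 0 \<le> - L t"
      by (rule nondecreasing_of_derivative_nonneg[where f' = "\<lambda>t. - L' t"])
        (use dL L'_nonpos that in \<open>auto intro!: derivative_intros\<close>)
    thus ?thesis by simp
  qed
  have ent: "0 \<le> rel_entropy us (u t)" "0 \<le> rel_entropy vs (v t)" if "0 \<le> t" for t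
    using rel_entropy_nonneg pos eq that by auto
  \<comment> \<open>Bounds on the orbit from \<open>L t \<le> L 0\<close>, widened so that the square contains \<open>(us, vs)\<close>.\<close>
  define m where "m = min (min us vs) (min (us * exp (- (L 0 / us + 1))) (vs * exp (- (L 0 / vs + 1))))"
  define M where "M = max (max us vs) (max (2 * (L 0 + us)) (2 * (L 0 + vs)))"
  have m: "0 < m" "m \<le> us" "m \<le> vs" and M: "0 < M" "us \<le> M" "vs \<le> M"
    using eq by (auto simp: m_def M_def)
  have bnd: "m \<le> u t" "m \<le> v t" "u t \<le> M" "v t \<le> M" if t: "0 \<le> t" for t
  proof -
    have "rel_entropy us (u t) \<le> L 0" "rel_entropy vs (v t) \<le> L 0"
      using L_le[OF t] ent[OF t] by (auto simp: L_def[of t])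
    from this[THEN rel_entropy_sublevel(1)[rotated 2]] this[THEN rel_entropy_sublevel(2)[rotated 2]]
    show "m \<le> u t" "m \<le> v t" "u t \<le> M" "v t \<le> M"
      using pos[OF t] eq by (auto simp: m_def M_def min_le_iff_disj le_max_iff_disj)
  qed
  define K where "K = (2 + s) / 2 * M powr (- (2 + s) / 2 - 1) * (c / 16)"
  have K: "0 < K" unfolding K_def by (rule monotonicity_constant_pos[OF M(1)])
  have L_D: "L t \<le> D t / m" if t: "0 \<le> t" for t
  proof -
    have "L t \<le> (u t - us)\<^sup>2 / u t + (v t - vs)\<^sup>2 / v t"
      unfolding L_def using pos[OF t] eq by (intro add_mono rel_entropy_upper)
    also have "\<dots> \<le> (u t - us)\<^sup>2 / m + (v t - vs)\<^sup>2 / m"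
      using bnd[OF t] m by (intro add_mono divide_left_mono) auto
    finally show ?thesis by (simp add: D_def add_divide_distrib)
  qed
  have D_L: "D t \<le> 4 * M * L t" if t: "0 \<le> t" for t
  proof -
    have *: "x\<^sup>2 \<le> 4 * M * h" if "x\<^sup>2 / (2 * y) \<le> h" "0 < y" "y \<le> 2 * M" for x y h :: real
    proof -
      have "x\<^sup>2 / (4 * M) \<le> x\<^sup>2 / (2 * y)" using that M by (intro divide_left_mono) auto
      hence "x\<^sup>2 / (4 * M) \<le> h" using that(1) by (rule order_trans)
      thus ?thesis using M by (simp add: field_simps)
    qed
    have "(u t - us)\<^sup>2 \<le> 4 * M * rel_entropy us (u t)"
      by (rule *[OF rel_entropy_lower[OF pos(1)[OF t] eq(3)]]) (use bnd[OF t] pos[OF t] M eq in auto)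
    moreover have "(v t - vs)\<^sup>2 \<le> 4 * M * rel_entropy vs (v t)"
      by (rule *[OF rel_entropy_lower[OF pos(2)[OF t] eq(4)]]) (use bnd[OF t] pos[OF t] M eq in auto)
    ultimately show ?thesis by (simp add: D_def L_def distrib_left)
  qed
  define k where "k = 4 * K * m"
  have k: "0 < k" using K m by (simp add: k_def)
  have L'_k: "L' t \<le> - k * L t" if t: "0 \<le> t" for t
  proof -
    have "L' t \<le> 4 * (- K * D t)" unfolding L'_def D_def K_def
      by (intro mult_left_mono monotonicity_at_equilibrium) (use eq pos[OF t] bnd[OF t] M in auto)
    also have "\<dots> \<le> - k * L t"
      using mult_left_mono[OF L_D[OF t], of k] k m by (simp add: k_def)
    finally show ?thesis .
  qed
  have decay: "L t \<le> L 0 * exp (- k * t)" if t: "0 \<le> t" for t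
  proof -
    have "- (L 0 * exp (k * 0)) \<le> - (L t * exp (k * t))"
    proof (rule nondecreasing_of_derivative_nonneg[where f' = "\<lambda>t. - ((L' t + k * L t) * exp (k * t))"])
      show "((\<lambda>t. - (L t * exp (k * t))) has_real_derivative - ((L' t + k * L t) * exp (k * t)))
        (at t within {0..})" if "0 \<le> t" for t
        by (auto intro!: derivative_eq_intros dL[OF that] simp: algebra_simps)
      show "0 \<le> - ((L' t + k * L t) * exp (k * t))" if "0 \<le> t" for t
        using L'_k[OF that] by (simp add: mult_le_0_iff)
    qed (rule t)
    thus ?thesis by (simp add: exp_minus field_simps)
  qed
  define W where "W = s / 2 * (1 + m powr (- (2 + s) / 2) * measure N (space N))"
  have W: "0 \<le> W" using s_pos by (simp add: W_def)
  define C where "C = (1 + W) * (sqrt (8 * M * L 0) + 1)"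
  have L0: "0 \<le> L 0" using ent[of 0] by (simp add: L_def)
  have C: "0 < C" unfolding C_def using W L0 M by (intro mult_pos_pos add_nonneg_pos add_pos_nonneg) auto
  have dist: "\<bar>u t - us\<bar> + \<bar>v t - vs\<bar> \<le> sqrt (8 * M * L 0) * exp (- (k / 2) * t)" if t: "0 \<le> t" for t
  proof (rule power2_le_imp_le)
    have "(x + y)\<^sup>2 \<le> 2 * (x\<^sup>2 + y\<^sup>2)" for x y :: real
      using zero_le_power2[of "x - y"] by (simp add: power2_sum power2_diff)
    from this[of "\<bar>u t - us\<bar>" "\<bar>v t - vs\<bar>"]
    have "(\<bar>u t - us\<bar> + \<bar>v t - vs\<bar>)\<^sup>2 \<le> 2 * D t" by (simp only: D_def power2_abs)
    also have "\<dots> \<le> 2 * (4 * M * (L 0 * exp (- k * t)))"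
      using D_L[OF t] mult_left_mono[OF decay[OF t], of "4 * M"] M by linarith
    also have "\<dots> = (sqrt (8 * M * L 0) * exp (- (k / 2) * t))\<^sup>2"
      using M L0 by (simp add: power_mult_distrib flip: exp_of_nat_mult)
    finally show "(\<bar>u t - us\<bar> + \<bar>v t - vs\<bar>)\<^sup>2 \<le> (sqrt (8 * M * L 0) * exp (- (k / 2) * t))\<^sup>2" .
  qed (use M L0 in simp)
  have "\<bar>u t - us\<bar> + \<bar>v t - vs\<bar> \<le> C * exp (- (k / 2) * t)
    \<and> E (u t) (v t) - E us vs \<le> C * exp (- (k / 2) * t)" if t: "0 \<le> t" for t
  proof
    have S: "0 \<le> sqrt (8 * M * L 0)" using M L0 by simp
    have "sqrt (8 * M * L 0) * exp (- (k / 2) * t) \<le> C * exp (- (k / 2) * t)"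
      unfolding C_def using W S by (intro mult_right_mono) (auto simp: algebra_simps)
    thus "\<bar>u t - us\<bar> + \<bar>v t - vs\<bar> \<le> C * exp (- (k / 2) * t)"
      using dist[OF t] by (rule order_trans[rotated])
    have "E (u t) (v t) - E us vs \<le> W * (\<bar>u t - us\<bar> + \<bar>v t - vs\<bar>)"
      unfolding W_def by (rule free_energy_lipschitz) (use m bnd[OF t] in auto)
    also have "\<dots> \<le> W * (sqrt (8 * M * L 0) * exp (- (k / 2) * t))"
      by (intro mult_left_mono dist t W)
    also have "\<dots> = W * sqrt (8 * M * L 0) * exp (- (k / 2) * t)" by simp
    also have "\<dots> \<le> C * exp (- (k / 2) * t)"
      unfolding C_def using W S by (intro mult_right_mono) (auto simp: algebra_simps)
    finally show "E (u t) (v t) - E us vs \<le> C * exp (- (k / 2) * t)" .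
  qed
  moreover have "0 < k / 2" using k by simp
  ultimately show ?thesis using C by blast
qed

end

section \<open>Boundedness of the angular Fourier transform\<close>

text \<open>
  Up to \<open>pi / 3\<close> the derivative \<open>cos\<close> is at least \<open>1 / 2\<close>; beyond it \<open>sin\<close> is at least
  \<open>sqrt 3 / 2\<close>, while \<open>y / 2 \<le> pi / 4\<close>.
\<close>

lemma abs_sin_ge:
  fixes x :: real
  assumes "\<bar>x\<bar> \<le> pi / 2"
  shows "\<bar>x\<bar> / 2 \<le> \<bar>sin x\<bar>"
proof -
  have "y / 2 \<le> sin y" if y: "0 \<le> y" "y \<le> pi / 2" for y :: real
  proof (cases "y \<le> pi / 3")
    case True
    have "sin 0 - 0 / 2 \<le> sin y - y / 2"
    proof (rule DERIV_nonneg_imp_nondecreasing[OF y(1)])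
      fix x assume x: "0 \<le> x" "x \<le> y"
      have "cos (pi / 3) \<le> cos x" using x True by (intro cos_monotone_0_pi_le) auto
      thus "\<exists>d. ((\<lambda>x. sin x - x / 2) has_real_derivative d) (at x) \<and> 0 \<le> d"
        by (intro exI[of _ "cos x - 1 / 2"]) (auto intro!: derivative_eq_intros simp: cos_60)
    qed
    thus ?thesis by simp
  next
    case False
    have "sin (pi / 3) \<le> sin y" using y False by (intro sin_monotone_2pi_le) auto
    moreover have "y / 2 \<le> 4 / 5" using y pi_less_4 pi_approx by simp
    moreover have "(8 / 5 :: real) \<le> sqrt 3" by (rule real_le_rsqrt) (simp add: power2_eq_square)
    ultimately show ?thesis unfolding sin_60 by linarith
  qed
  from this[of "\<bar>x\<bar>"] assms show ?thesis by (cases "0 \<le> x") auto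
qed

lemma smooth_fun_C1:
  assumes "smooth_fun f"
  shows "\<And>x. (f has_real_derivative deriv f x) (at x)" and "continuous_on UNIV (deriv f)"
    and "continuous_on UNIV f"
proof -
  have d: "(deriv ^^ n) f differentiable (at x)" for n x using assms by (auto simp: smooth_fun_def)
  show f: "(f has_real_derivative deriv f x) (at x)" for x
    using d[of 0 x] by (simp add: DERIV_deriv_iff_real_differentiable)
  show "continuous_on UNIV (deriv f)"
    using d[of 1] by (auto simp: continuous_on_eq_continuous_within intro!: differentiable_imp_continuous_within)
  show "continuous_on UNIV f"
    using d[of 0] by (auto simp: continuous_on_eq_continuous_within intro!: differentiable_imp_continuous_within)
qed

lemma smooth_fun_lipschitz_on_interval:
  assumes "smooth_fun f"
  shows "\<exists>L\<ge>0. \<forall>x\<in>{a..b}. \<forall>y\<in>{a..b}. \<bar>f x - f y\<bar> \<le> L * \<bar>x - y\<bar>"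
proof -
  have "compact (deriv f ` {a..b})"
    by (intro compact_continuous_image continuous_on_subset[OF smooth_fun_C1(2)[OF assms]]) auto
  then obtain L where L: "\<And>x. x \<in> {a..b} \<Longrightarrow> \<bar>deriv f x\<bar> \<le> L"
    unfolding real_norm_def[symmetric] using compact_imp_bounded bounded_pos image_eqI by (metis (no_types, lifting))
  have "norm (f x - f y) \<le> max 0 L * norm (x - y)" if "x \<in> {a..b}" "y \<in> {a..b}" for x y
    by (rule field_differentiable_bound[where f' = "deriv f" and S = "{a..b}"])
       (use that L smooth_fun_C1(1)[OF assms] in \<open>force intro: has_field_derivative_at_within\<close>)+
  thus ?thesis by (intro exI[of _ "max 0 L"]) auto
qed

lemma pi_periodic_int:
  fixes f :: "real \<Rightarrow> real"
  assumes "\<And>x. f (x + pi) = f x"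
  shows "f (x + of_int k * pi) = f x"
proof (induction k rule: int_induct[where k = 0])
  case (step1 i)
  thus ?case using assms[of "x + of_int i * pi"] by (simp add: algebra_simps)
next
  case (step2 i)
  thus ?case using assms[of "x + of_int (i - 1) * pi"] by (simp add: algebra_simps)
qed simp

lemma abs_cos_shift_int: "\<bar>cos (x + of_int k * pi)\<bar> = \<bar>cos x\<bar>"
  by (rule pi_periodic_int[where f = "\<lambda>x. \<bar>cos x\<bar>"]) simp

lemma integrable_abs_powr:
  fixes e R :: real
  assumes "- 1 < e" "0 \<le> R"
  shows "integrable lborel (\<lambda>x. indicator {- R..R} x * \<bar>x\<bar> powr e)"
proof -
  have "(\<lambda>x. x powr e) absolutely_integrable_on {0..R}"
    using integrable_on_powr_from_0[OF assms] by (subst absolutely_integrable_on_iff_nonneg) auto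
  hence 1: "integrable lborel (\<lambda>x. indicator {0..R} x * x powr e)"
    unfolding set_integrable_def by (subst (asm) integrable_completion) simp_all
  hence "integrable lborel (\<lambda>x. indicator {0..R} (0 + -1 * x) * (0 + -1 * x) powr e)"
    by (intro lborel_integrable_real_affine) auto
  hence 2: "integrable lborel (\<lambda>x. indicator {0..R} (- x) * (- x) powr e)" by simp
  show ?thesis
  proof (rule Bochner_Integration.integrable_bound[OF Bochner_Integration.integrable_add[OF 1 2]])
    show "AE x in lborel. norm (indicator {- R..R} x * \<bar>x\<bar> powr e)
      \<le> norm (indicator {0..R} x * x powr e + indicator {0..R} (- x) * (- x) powr e)"
      by (intro AE_I2) (auto simp: indicator_def)
  qed measurable
qed

text \<open>
  Let \<open>d\<close> be the distance of \<open>\<theta>\<close> to the nearest zero \<open>\<phi> + pi / 2 + k pi\<close> of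
  \<open>cos (\<phi> - \<theta>)\<close>. The cosine is at least \<open>d / 2\<close> in absolute value, and the other factor is at most
  \<open>L d\<close> because \<open>\<Omega>\<close> takes the same value at all these zeros. As \<open>k\<close> depends on \<open>\<theta>\<close>, the bound
  sums over all values that occur; the cut-off at \<open>10 pi\<close> makes each term integrable on the line.
\<close>

lemma Omega_tilde_integrand_bound:
  assumes s: "0 < s" "s < 1" and per: "\<And>x. \<Omega> (x + pi) = \<Omega> x" and "0 \<le> L"
    and L: "\<And>x y. x \<in> {-2 * pi..2 * pi} \<Longrightarrow> y \<in> {-2 * pi..2 * pi} \<Longrightarrow> \<bar>\<Omega> x - \<Omega> y\<bar> \<le> L * \<bar>x - y\<bar>"
    and phi: "-pi \<le> \<phi>" "\<phi> \<le> pi" and theta: "-pi \<le> \<theta>" "\<theta> \<le> pi"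
  shows "\<bar>\<bar>cos (\<phi> - \<theta>)\<bar> powr (- 2 + s) * (\<Omega> \<theta> - \<Omega> (\<phi> + pi / 2))\<bar>
    \<le> 2 powr (2 - s) * L * (\<Sum>k\<in>{-3..3::int}. indicator {-10 * pi..10 * pi} (\<theta> - (\<phi> + pi / 2 + of_int k * pi)) *
        \<bar>\<theta> - (\<phi> + pi / 2 + of_int k * pi)\<bar> powr (s - 1))"
proof -
  define k where "k = round ((\<theta> - (\<phi> + pi / 2)) / pi)"
  define y where "y = \<phi> + pi / 2 + of_int k * pi"
  define d where "d = \<theta> - y"
  have "\<bar>of_int k - (\<theta> - (\<phi> + pi / 2)) / pi\<bar> \<le> 1 / 2" unfolding k_def by (rule of_int_round_abs_le)
  hence "\<bar>of_int k - (\<theta> - (\<phi> + pi / 2)) / pi\<bar> * pi \<le> 1 / 2 * pi" by (rule mult_right_mono) simp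
  hence "\<bar>(of_int k - (\<theta> - (\<phi> + pi / 2)) / pi) * pi\<bar> \<le> 1 / 2 * pi" by (simp add: abs_mult)
  moreover have "(of_int k - (\<theta> - (\<phi> + pi / 2)) / pi) * pi = - d" unfolding d_def y_def by (simp add: field_simps)
  ultimately have d: "\<bar>d\<bar> \<le> pi / 2" by simp
  have "\<bar>of_int k * pi\<bar> \<le> 3 * pi" using d phi theta unfolding d_def y_def by linarith
  hence "\<bar>real_of_int k\<bar> * pi \<le> 3 * pi" by (simp add: abs_mult)
  hence "\<bar>real_of_int k\<bar> \<le> 3" by (rule mult_right_le_imp_le) simp
  hence k: "k \<in> {-3..3}" by (auto simp: abs_le_iff)
  have cos: "\<bar>cos (\<phi> - \<theta>)\<bar> = \<bar>sin d\<bar>"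
  proof -
    have "\<bar>cos (\<phi> - \<theta>)\<bar> = \<bar>cos (\<theta> - \<phi>)\<bar>" using cos_minus[of "\<phi> - \<theta>"] by simp
    also have "\<dots> = \<bar>cos ((d + pi / 2) + of_int k * pi)\<bar>"
      unfolding d_def y_def by (simp add: algebra_simps)
    also have "\<dots> = \<bar>sin d\<bar>" unfolding abs_cos_shift_int by (simp add: cos_add)
    finally show ?thesis .
  qed
  have Om: "\<bar>\<Omega> \<theta> - \<Omega> (\<phi> + pi / 2)\<bar> \<le> L * \<bar>d\<bar>"
  proof -
    have "\<Omega> (\<phi> + pi / 2) = \<Omega> y" unfolding y_def using pi_periodic_int[of \<Omega>, OF per] by simp
    moreover have "- 2 * pi \<le> y" "y \<le> 2 * pi" using d theta unfolding d_def by linarith+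
    hence "\<bar>\<Omega> \<theta> - \<Omega> y\<bar> \<le> L * \<bar>\<theta> - y\<bar>"
      by (intro L) (use theta in auto)
    ultimately show ?thesis by (simp add: d_def)
  qed
  let ?t = "\<lambda>k::int. indicator {-10 * pi..10 * pi} (\<theta> - (\<phi> + pi / 2 + of_int k * pi)) *
        \<bar>\<theta> - (\<phi> + pi / 2 + of_int k * pi)\<bar> powr (s - 1)"
  have t: "?t k \<le> (\<Sum>k\<in>{-3..3::int}. ?t k)"
    by (rule member_le_sum[OF k]) (auto simp: indicator_def)
  have tk: "?t k = \<bar>d\<bar> powr (s - 1)"
  proof -
    have "\<theta> - (\<phi> + pi / 2 + of_int k * pi) = d" by (simp add: d_def y_def)
    moreover have "d \<in> {-10 * pi..10 * pi}" using d by (simp add: abs_le_iff) (use pi_gt_zero in linarith)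
    ultimately show ?thesis by simp
  qed
  have "\<bar>sin d\<bar> powr (- 2 + s) * (L * \<bar>d\<bar>) \<le> 2 powr (2 - s) * L * \<bar>d\<bar> powr (s - 1)"
  proof (cases "d = 0")
    case False
    hence "\<bar>sin d\<bar> powr (- 2 + s) \<le> (\<bar>d\<bar> / 2) powr (- 2 + s)"
      using abs_sin_ge[OF d] s by (intro powr_mono2') auto
    also have "\<dots> = 2 powr (2 - s) * \<bar>d\<bar> powr (- 2 + s)"
      using powr_minus_divide[of 2 "2 - s"] by (simp add: powr_divide)
    finally have "\<bar>sin d\<bar> powr (- 2 + s) * (L * \<bar>d\<bar>) \<le> 2 powr (2 - s) * \<bar>d\<bar> powr (- 2 + s) * (L * \<bar>d\<bar>)"
      using \<open>0 \<le> L\<close> by (intro mult_right_mono) auto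
    also have "\<bar>d\<bar> powr (s - 1) = \<bar>d\<bar> powr (- 2 + s) * \<bar>d\<bar>"
      using False powr_add[of "\<bar>d\<bar>" "- 2 + s" 1] by simp
    hence "2 powr (2 - s) * \<bar>d\<bar> powr (- 2 + s) * (L * \<bar>d\<bar>) = 2 powr (2 - s) * L * \<bar>d\<bar> powr (s - 1)"
      by simp
    finally show ?thesis .
  qed simp
  moreover have "\<bar>\<bar>cos (\<phi> - \<theta>)\<bar> powr (- 2 + s) * (\<Omega> \<theta> - \<Omega> (\<phi> + pi / 2))\<bar>
    \<le> \<bar>sin d\<bar> powr (- 2 + s) * (L * \<bar>d\<bar>)"
    unfolding abs_mult cos using Om by (intro mult_mono) auto
  moreover have "2 powr (2 - s) * L * \<bar>d\<bar> powr (s - 1) \<le> 2 powr (2 - s) * L * (\<Sum>k\<in>{-3..3::int}. ?t k)"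
    using t \<open>0 \<le> L\<close> unfolding tk by (intro mult_left_mono) auto
  ultimately show ?thesis by linarith
qed

text \<open>
  After the pointwise bound, translation invariance of the Lebesgue measure makes the integral of
  each of the seven terms independent of \<open>\<phi>\<close>.
\<close>

lemma Omega_tilde_bounded:
  assumes s: "0 < s" "s < 1" and sm: "smooth_fun \<Omega>" and per: "\<And>x. \<Omega> (x + pi) = \<Omega> x"
  shows "\<exists>D. \<forall>\<phi>\<in>{-pi..pi}. \<bar>Omega_tilde s \<Omega> \<phi>\<bar> \<le> D"
proof -
  obtain L where L: "0 \<le> L" "\<And>x y. x \<in> {-2 * pi..2 * pi} \<Longrightarrow> y \<in> {-2 * pi..2 * pi} \<Longrightarrow> \<bar>\<Omega> x - \<Omega> y\<bar> \<le> L * \<bar>x - y\<bar>"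
    using smooth_fun_lipschitz_on_interval[OF sm, of "-2 * pi" "2 * pi"] by blast
  have [measurable]: "\<Omega> \<in> borel_measurable borel"
    using smooth_fun_C1(3)[OF sm] by (rule borel_measurable_continuous_onI)
  define h where "h x = indicator {- (10 * pi)..10 * pi} x * \<bar>x\<bar> powr (s - 1)" for x :: real
  have h: "integrable lborel h" unfolding h_def using s by (intro integrable_abs_powr) auto
  define H where "H = (\<integral>x. h x \<partial>lborel)"
  have sh: "integrable lborel (\<lambda>x. h (x - p))" "(\<integral>x. h (x - p) \<partial>lborel) = H" for p
    using lborel_integrable_real_affine[OF h, of 1 "-p"] lborel_integral_real_affine[of 1 h "-p"]
    by (simp_all add: H_def)
  define D where "D = \<bar>tau (2 - s)\<bar> * (2 powr (2 - s) * L * (7 * H))"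
  have "compact (\<Omega> ` {-2 * pi..2 * pi})"
    by (intro compact_continuous_image continuous_on_subset[OF smooth_fun_C1(3)[OF sm]]) auto
  then obtain M where M: "\<And>x. x \<in> {-2 * pi..2 * pi} \<Longrightarrow> \<bar>\<Omega> x\<bar> \<le> M"
    unfolding real_norm_def[symmetric] using compact_imp_bounded bounded_pos image_eqI by (metis (no_types, lifting))
  have "\<bar>Omega_tilde s \<Omega> \<phi>\<bar> \<le> D + \<bar>c_const s\<bar> * M" if phi: "\<phi> \<in> {-pi..pi}" for \<phi>
  proof -
    let ?g = "\<lambda>\<theta>. \<bar>cos (\<phi> - \<theta>)\<bar> powr (- 2 + s) * (\<Omega> \<theta> - \<Omega> (\<phi> + pi / 2))"
    let ?S = "\<lambda>\<theta>. 2 powr (2 - s) * L * (\<Sum>k\<in>{-3..3::int}. h (\<theta> - (\<phi> + pi / 2 + of_int k * pi)))"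
    have S_int: "integrable lborel ?S" by (intro integrable_mult_right Bochner_Integration.integrable_sum sh)
    have S_val: "(\<integral>\<theta>. ?S \<theta> \<partial>lborel) = 2 powr (2 - s) * L * (7 * H)"
      by (simp add: sh)
    have pt: "norm (indicator {-pi..pi} \<theta> *\<^sub>R ?g \<theta>) \<le> ?S \<theta>" for \<theta>
    proof (cases "\<theta> \<in> {-pi..pi}")
      case True
      thus ?thesis using Omega_tilde_integrand_bound[OF s per L, of \<phi> \<theta>] phi by (simp add: h_def)
    next
      case False
      have "0 \<le> ?S \<theta>" using L(1) by (intro mult_nonneg_nonneg sum_nonneg) (auto simp: h_def)
      thus ?thesis using False by simp
    qed
    have "norm (LBINT \<theta>:{-pi..pi}. ?g \<theta>) \<le> (\<integral>\<theta>. ?S \<theta> \<partial>lborel)"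
      unfolding set_lebesgue_integral_def
    proof (rule Bochner_Integration.integral_norm_bound_integral[OF _ S_int])
      show "integrable lborel (\<lambda>\<theta>. indicator {-pi..pi} \<theta> *\<^sub>R ?g \<theta>)"
      proof (rule Bochner_Integration.integrable_bound[OF S_int])
        show "AE \<theta> in lborel. norm (indicator {-pi..pi} \<theta> *\<^sub>R ?g \<theta>) \<le> norm (?S \<theta>)"
          by (intro AE_I2 order_trans[OF pt]) simp
      qed measurable
    qed (rule pt)
    hence "\<bar>LBINT \<theta>:{-pi..pi}. ?g \<theta>\<bar> \<le> 2 powr (2 - s) * L * (7 * H)"
      unfolding S_val real_norm_def .
    hence "\<bar>tau (2 - s) * (LBINT \<theta>:{-pi..pi}. ?g \<theta>)\<bar> \<le> D"
      unfolding D_def abs_mult by (rule mult_left_mono) simp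
    moreover have "\<bar>c_const s * \<Omega> (\<phi> + pi / 2)\<bar> \<le> \<bar>c_const s\<bar> * M"
      unfolding abs_mult by (rule mult_left_mono[OF M]) (use phi in auto)
    ultimately show ?thesis unfolding Omega_tilde_def by linarith
  qed
  thus ?thesis by blast
qed

lemma Omega_tilde_measurable:
  assumes "smooth_fun \<Omega>"
  shows "Omega_tilde s \<Omega> \<in> borel_measurable borel"
proof -
  have [measurable]: "\<Omega> \<in> borel_measurable borel"
    using smooth_fun_C1(3)[OF assms] by (rule borel_measurable_continuous_onI)
  show ?thesis unfolding Omega_tilde_def[abs_def] set_lebesgue_integral_def by measurable
qed

lemma tau_pos: "0 < s \<Longrightarrow> s < 1 \<Longrightarrow> 0 < tau s"
  unfolding tau_def by (intro mult_pos_pos cos_gt_zero Gamma_real_pos) auto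

text \<open>
  In HOL \<open>x powr a\<close> is positive unless \<open>x = 0\<close>, so it suffices that the bases in
  \<open>R1\<close> and \<open>R2\<close> do not vanish.
\<close>

lemma R_ratio_pos:
  assumes "0 < s" "s < 1"
  shows "0 < (R1 s / R2 s) powr (2 + s)"
proof -
  have "0 < cos (s * pi / 2)" using assms by (intro cos_gt_zero) auto
  moreover have "0 < sin (s * pi / 2)" using assms by (intro sin_gt_zero) (auto simp: mult_less_cancel_right2)
  moreover have "0 < Beta (1 / 2) ((3 + s) / 2)"
    unfolding Beta_def using assms
    by (intro divide_pos_pos mult_pos_pos Gamma_real_pos add_pos_pos) auto
  ultimately have "R1 s \<noteq> 0" "R2 s \<noteq> 0"
    unfolding R1_def R2_def using assms by (auto simp: add_pos_pos)
  thus ?thesis by simp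
qed

section \<open>The flow driven by the angular Fourier transform\<close>

definition circle_measure :: "(real \<Rightarrow> real) \<Rightarrow> real measure" where
  "circle_measure w = density lborel (\<lambda>x. ennreal (indicator {-pi..pi} x * w x))"

lemma integral_circle_measure:
  fixes f :: "real \<Rightarrow> real"
  assumes [measurable]: "w \<in> borel_measurable borel" "f \<in> borel_measurable borel" and "\<And>x. 0 \<le> w x"
  shows "(\<integral>x. f x \<partial>circle_measure w) = (LBINT x:{-pi..pi}. w x * f x)"
  unfolding circle_measure_def set_lebesgue_integral_def
  by (subst integral_density) (use assms in \<open>auto simp: mult.assoc\<close>)

text \<open>
  The upper bound makes the measure finite, the lower bound gives mass to the neighbourhoods of
  the two axes.
\<close>

lemma planar_weight_circle_measure:
  assumes w [measurable]: "w \<in> borel_measurable borel" and "0 < s" and k: "0 < k" "\<And>x. k \<le> w x"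
    and D: "\<And>x. x \<in> {-pi..pi} \<Longrightarrow> w x \<le> D"
  shows "planar_weight (circle_measure w) s k (\<lambda>x. (cos x)\<^sup>2) (\<lambda>x. (sin x)\<^sup>2) 0 (pi / 2)"
proof -
  let ?N = "circle_measure w"
  have w0: "0 \<le> w x" for x using k(2)[of x] k(1) by linarith
  have "integrable lborel (\<lambda>x. indicator {-pi..pi} x * D)"
    by (intro integrable_mult_left) simp
  hence int: "integrable lborel (\<lambda>x. indicator {-pi..pi} x * w x)"
    by (rule Bochner_Integration.integrable_bound)
      (use D w0 in \<open>auto intro!: AE_I2 simp: indicator_def order_trans[OF _ abs_ge_self]\<close>)
  have fin: "finite_measure ?N"
  proof (rule finite_measureI)
    have "emeasure ?N (space ?N) = (\<integral>\<^sup>+x. ennreal (indicator {-pi..pi} x * w x) \<partial>lborel)"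
      unfolding circle_measure_def by (subst emeasure_density) auto
    also have "\<dots> = ennreal (\<integral>x. indicator {-pi..pi} x * w x \<partial>lborel)"
      by (rule nn_integral_eq_integral[OF int]) (use w0 in auto)
    finally show "emeasure ?N (space ?N) \<noteq> \<infinity>" by simp
  qed
  interpret finite_measure ?N by (rule fin)
  have mass: "k * d \<le> measure ?N {x - d..x + d}"
    if d: "0 \<le> d" and sub: "{x - d..x + d} \<subseteq> {-pi..pi}" for x d
  proof -
    have "ennreal (k * (2 * d)) = ennreal k * emeasure lborel {x - d..x + d}"
      using d k by (simp add: ennreal_mult)
    also have "\<dots> = (\<integral>\<^sup>+y. ennreal k * indicator {x - d..x + d} y \<partial>lborel)"
      by (simp add: nn_integral_cmult_indicator)
    also have "\<dots> \<le> (\<integral>\<^sup>+y. ennreal (indicator {-pi..pi} y * w y) * indicator {x - d..x + d} y \<partial>lborel)"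
      by (rule nn_integral_mono) (use sub k in \<open>auto simp: indicator_def ennreal_leI\<close>)
    also have "\<dots> = emeasure ?N {x - d..x + d}"
      unfolding circle_measure_def by (subst emeasure_density) auto
    finally have "k * (2 * d) \<le> measure ?N {x - d..x + d}"
      unfolding emeasure_eq_measure by (subst (asm) ennreal_le_iff) auto
    moreover have "0 \<le> k * d" using k d by simp
    ultimately show ?thesis by linarith
  qed
  have sin_le: "(sin x)\<^sup>2 \<le> x\<^sup>2" for x :: real
    using abs_sin_x_le_abs_x[of x] by (simp add: abs_le_square_iff)
  show ?thesis
  proof
    show "sets ?N = sets borel" by (simp add: circle_measure_def)
    show "(cos x)\<^sup>2 \<le> (x - pi / 2)\<^sup>2" for x
      using sin_le[of "pi / 2 - x"] by (simp add: sin_diff power2_commute)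
    show "k * d \<le> measure ?N {0 - d..0 + d}" if "0 \<le> d" "d \<le> 1" for d
      by (rule mass) (use that pi_gt3 in auto)
    show "k * d \<le> measure ?N {pi / 2 - d..pi / 2 + d}" if "0 \<le> d" "d \<le> 1" for d
      by (rule mass) (use that pi_gt3 in auto)
  qed (use sin_le k \<open>0 < s\<close> in auto)
qed

text \<open>
  The angular Fourier transform with the normalisation of the flow, so that \<open>A_fun\<close>, \<open>B_fun\<close> and
  \<open>energy\<close> are exactly the abstract forces and energy.
\<close>

definition spectral_measure :: "real \<Rightarrow> (real \<Rightarrow> real) \<Rightarrow> real measure" where
  "spectral_measure s \<Omega> =
     circle_measure (\<lambda>\<phi>. tau s * (R1 s / R2 s) powr (2 + s) * Omega_tilde s \<Omega> \<phi>)"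

lemma integral_spectral_measure:
  assumes "0 < s" "s < 1" "smooth_fun \<Omega>" "0 < c" "\<And>\<phi>. c \<le> Omega_tilde s \<Omega> \<phi>"
    and f: "f \<in> borel_measurable borel"
  shows "(\<integral>x. f x \<partial>spectral_measure s \<Omega>) =
    tau s * (R1 s / R2 s) powr (2 + s) * (LBINT \<phi>:{-pi..pi}. f \<phi> * Omega_tilde s \<Omega> \<phi>)"
proof -
  let ?K = "tau s * (R1 s / R2 s) powr (2 + s)"
  have K: "0 < ?K" using tau_pos R_ratio_pos assms by (intro mult_pos_pos)
  have "0 \<le> ?K * Omega_tilde s \<Omega> \<phi>" for \<phi>
    using mult_left_mono[OF order_trans[OF less_imp_le[OF assms(4)] assms(5)] less_imp_le[OF K], of \<phi>]
    by simp
  hence "(\<integral>x. f x \<partial>spectral_measure s \<Omega>) = (LBINT \<phi>:{-pi..pi}. ?K * Omega_tilde s \<Omega> \<phi> * f \<phi>)"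
    unfolding spectral_measure_def using Omega_tilde_measurable[OF assms(3)] f
    by (intro integral_circle_measure) auto
  also have "\<dots> = (LBINT \<phi>:{-pi..pi}. ?K * (f \<phi> * Omega_tilde s \<Omega> \<phi>))"
    by (simp only: mult.assoc mult.commute[of "f _"])
  finally show ?thesis by simp
qed

lemma planar_weight_spectral_measure:
  assumes s: "0 < s" "s < 1" and sm: "smooth_fun \<Omega>" and per: "\<And>\<theta>. \<Omega> (\<theta> + pi) = \<Omega> \<theta>"
    and c: "0 < c" "\<And>\<phi>. c \<le> Omega_tilde s \<Omega> \<phi>"
  shows "planar_weight (spectral_measure s \<Omega>) s (tau s * (R1 s / R2 s) powr (2 + s) * c)
    (\<lambda>x. (cos x)\<^sup>2) (\<lambda>x. (sin x)\<^sup>2) 0 (pi / 2)"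
proof -
  let ?K = "tau s * (R1 s / R2 s) powr (2 + s)"
  have K: "0 < ?K" using tau_pos R_ratio_pos s by (intro mult_pos_pos)
  obtain D where D: "\<And>\<phi>. \<phi> \<in> {-pi..pi} \<Longrightarrow> \<bar>Omega_tilde s \<Omega> \<phi>\<bar> \<le> D"
    using Omega_tilde_bounded[OF s sm per] by blast
  show ?thesis unfolding spectral_measure_def
  proof (rule planar_weight_circle_measure[where D = "?K * D"])
    show "(\<lambda>\<phi>. ?K * Omega_tilde s \<Omega> \<phi>) \<in> borel_measurable borel"
      using Omega_tilde_measurable[OF sm, of s] by measurable
    show "0 < ?K * c" using K c by simp
    show "?K * c \<le> ?K * Omega_tilde s \<Omega> \<phi>" for \<phi>
      using K c by (intro mult_left_mono) simp_all
    show "?K * Omega_tilde s \<Omega> \<phi> \<le> ?K * D" if "\<phi> \<in> {-pi..pi}" for \<phi>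
      using D[OF that] K by (intro mult_left_mono) (simp_all add: abs_le_iff)
  qed (rule s)
qed

lemma A_fun_eq_force:
  assumes "0 < s" "s < 1" "smooth_fun \<Omega>" "0 < c" "\<And>\<phi>. c \<le> Omega_tilde s \<Omega> \<phi>"
  shows "A_fun s \<Omega> a b
    = force (spectral_measure s \<Omega>) s (\<lambda>x. (cos x)\<^sup>2) (\<lambda>x. (sin x)\<^sup>2) (a\<^sup>2) (b\<^sup>2)"
  unfolding A_fun_def force_def by (subst integral_spectral_measure[OF assms]) simp_all

lemma B_fun_eq_force:
  assumes "0 < s" "s < 1" "smooth_fun \<Omega>" "0 < c" "\<And>\<phi>. c \<le> Omega_tilde s \<Omega> \<phi>"
  shows "B_fun s \<Omega> a b
    = force (spectral_measure s \<Omega>) s (\<lambda>x. (sin x)\<^sup>2) (\<lambda>x. (cos x)\<^sup>2) (b\<^sup>2) (a\<^sup>2)"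
  unfolding B_fun_def force_def
  by (subst integral_spectral_measure[OF assms]) (simp_all add: add.commute)

lemma energy_eq_free_energy:
  assumes "0 < s" "s < 1" "smooth_fun \<Omega>" "0 < c" "\<And>\<phi>. c \<le> Omega_tilde s \<Omega> \<phi>"
  shows "energy s \<Omega> a b
    = free_energy (spectral_measure s \<Omega>) s (\<lambda>x. (cos x)\<^sup>2) (\<lambda>x. (sin x)\<^sup>2) (a\<^sup>2) (b\<^sup>2)"
  unfolding energy_def free_energy_def by (subst integral_spectral_measure[OF assms]) simp_all

theorem theorem4p2:
  fixes s c :: real and \<Omega> a b :: "real \<Rightarrow> real" and a0 b0 a_inf b_inf :: real
  assumes "0 < s" and "s < 1"
    and "smooth_fun \<Omega>"
    and "\<And>\<theta>. 0 < \<Omega> \<theta>"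
    and "\<And>\<theta>. \<Omega> (\<theta> + pi) = \<Omega> \<theta>"
    and "0 < c" and "\<And>\<phi>. c \<le> Omega_tilde s \<Omega> \<phi>"
    and "solves_flow s \<Omega> a b"
    and "a 0 = a0" and "b 0 = b0" and "0 < a0" and "0 < b0"
    and "(a_inf, b_inf) = equilibrium s \<Omega>"
  shows "(\<exists>C>0. \<exists>\<kappa>>0. \<forall>t\<ge>0.
            energy s \<Omega> (a t) (b t) - energy s \<Omega> a_inf b_inf \<le> C * exp (- \<kappa> * t)) \<and>
         ((\<lambda>t. (a t, b t)) \<longlongrightarrow> (a_inf, b_inf)) at_top"
proof -
  let ?p = "\<lambda>x :: real. (cos x)\<^sup>2" and ?q = "\<lambda>x :: real. (sin x)\<^sup>2"
  let ?N = "spectral_measure s \<Omega>"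
  note hyps = assms(1-3,6,7)
  interpret planar_weight ?N s "tau s * (R1 s / R2 s) powr (2 + s) * c" ?p ?q 0 "pi / 2"
    by (rule planar_weight_spectral_measure) (use assms in auto)
  interpret sw: planar_weight ?N s "tau s * (R1 s / R2 s) powr (2 + s) * c" ?q ?p "pi / 2" 0
    by (rule planar_weight_swap)
  note Af = A_fun_eq_force[OF hyps] and Bf = B_fun_eq_force[OF hyps] and Ef = energy_eq_free_energy[OF hyps]
  define P where "P z \<longleftrightarrow> 0 < fst z \<and> 0 < snd z \<and>
    A_fun s \<Omega> (fst z) (snd z) = 1 \<and> B_fun s \<Omega> (fst z) (snd z) = 1" for z :: "real \<times> real"
  have "\<exists>!z. P z"
  proof (rule ex_ex1I)
    obtain u v where "0 < u" "0 < v" "A u v = 1" "B u v = 1" using equilibrium_exists by blast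
    hence "P (sqrt u, sqrt v)" unfolding P_def Af Bf by simp
    thus "\<exists>z. P z" ..
    show "y = z" if "P y" "P z" for y z
    proof -
      have "(fst z)\<^sup>2 = (fst y)\<^sup>2 \<and> (snd z)\<^sup>2 = (snd y)\<^sup>2"
        using that unfolding P_def Af Bf by (intro equilibrium_unique) auto
      hence "fst z = fst y" "snd z = snd y"
        using that unfolding P_def by (auto simp: power2_eq_iff_nonneg)
      thus ?thesis by (simp add: prod_eq_iff)
    qed
  qed
  hence "P (THE z. P z)" by (rule theI')
  moreover have "(a_inf, b_inf) = (THE z. P z)" using assms(13) unfolding equilibrium_def P_def .
  ultimately have inf: "0 < a_inf" "0 < b_inf" "A (a_inf\<^sup>2) (b_inf\<^sup>2) = 1" "B (a_inf\<^sup>2) (b_inf\<^sup>2) = 1"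
    unfolding P_def Af Bf by (metis fst_conv snd_conv)+
  have da: "(a has_real_derivative 2 * (A ((a t)\<^sup>2) ((b t)\<^sup>2) - 1) * a t) (at t within {0..})"
    and db: "(b has_real_derivative 2 * (B ((a t)\<^sup>2) ((b t)\<^sup>2) - 1) * b t) (at t within {0..})"
    if "0 \<le> t" for t
    using assms(8) that unfolding solves_flow_def Af Bf by auto
  have a_pos: "0 < a t" if "0 \<le> t" for t
    by (rule linear_flow_positive[where k = 2, OF da _ _ that]) (use force_nonneg assms in auto)
  have b_pos: "0 < b t" if "0 \<le> t" for t
    by (rule linear_flow_positive[where k = 2, OF db _ _ that]) (use sw.force_nonneg assms in auto)
  have "\<exists>C>0. \<exists>r>0. \<forall>t\<ge>0. \<bar>(a t)\<^sup>2 - a_inf\<^sup>2\<bar> + \<bar>(b t)\<^sup>2 - b_inf\<^sup>2\<bar> \<le> C * exp (- r * t)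
     \<and> E ((a t)\<^sup>2) ((b t)\<^sup>2) - E (a_inf\<^sup>2) (b_inf\<^sup>2) \<le> C * exp (- r * t)"
  proof (rule flow_converges_exponentially[OF inf(3,4)])
    show "((\<lambda>t. (a t)\<^sup>2) has_real_derivative 4 * (A ((a t)\<^sup>2) ((b t)\<^sup>2) - 1) * (a t)\<^sup>2) (at t within {0..})"
      if "0 \<le> t" for t
      by (rule derivative_eq_intros da[OF that] refl | simp add: power2_eq_square)+
    show "((\<lambda>t. (b t)\<^sup>2) has_real_derivative 4 * (B ((a t)\<^sup>2) ((b t)\<^sup>2) - 1) * (b t)\<^sup>2) (at t within {0..})"
      if "0 \<le> t" for t
      by (rule derivative_eq_intros db[OF that] refl | simp add: power2_eq_square)+
    show "0 < (a t)\<^sup>2" "0 < (b t)\<^sup>2" if "0 \<le> t" for t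
      using a_pos[OF that] b_pos[OF that] by simp_all
  qed (use inf in simp_all)
  then obtain C r where Cr: "0 < C" "0 < r"
    and dist: "\<And>t. 0 \<le> t \<Longrightarrow> \<bar>(a t)\<^sup>2 - a_inf\<^sup>2\<bar> + \<bar>(b t)\<^sup>2 - b_inf\<^sup>2\<bar> \<le> C * exp (- r * t)"
    and en: "\<And>t. 0 \<le> t \<Longrightarrow> E ((a t)\<^sup>2) ((b t)\<^sup>2) - E (a_inf\<^sup>2) (b_inf\<^sup>2) \<le> C * exp (- r * t)"
    by blast
  have root: "(x \<longlongrightarrow> x_inf) at_top"
    if "\<And>t. 0 \<le> t \<Longrightarrow> 0 < x t" "0 < x_inf" "\<And>t. 0 \<le> t \<Longrightarrow> \<bar>(x t)\<^sup>2 - x_inf\<^sup>2\<bar> \<le> C * exp (- r * t)"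
    for x :: "real \<Rightarrow> real" and x_inf
  proof -
    have "filterlim (\<lambda>t. - r * t) at_bot at_top"
      by (rule filterlim_tendsto_neg_mult_at_bot[OF tendsto_const _ filterlim_ident]) (use Cr in simp)
    hence "((\<lambda>t. C * exp (- r * t)) \<longlongrightarrow> 0) at_top"
      by (intro tendsto_mult_right_zero filterlim_compose[OF exp_at_bot])
    moreover have "\<forall>\<^sub>F t in at_top. norm ((x t)\<^sup>2 - x_inf\<^sup>2) \<le> C * exp (- r * t)"
      using eventually_ge_at_top[of 0] by eventually_elim (use that(3) in simp)
    ultimately have "((\<lambda>t. (x t)\<^sup>2 - x_inf\<^sup>2) \<longlongrightarrow> 0) at_top" by (rule Lim_null_comparison[rotated])
    hence "((\<lambda>t. sqrt ((x t)\<^sup>2)) \<longlongrightarrow> sqrt (x_inf\<^sup>2)) at_top"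
      by (intro tendsto_real_sqrt) (rule LIM_zero_cancel)
    moreover have "\<forall>\<^sub>F t in at_top. sqrt ((x t)\<^sup>2) = x t"
      using eventually_ge_at_top[of 0] by eventually_elim (use that(1) in \<open>simp add: less_imp_le\<close>)
    ultimately show ?thesis using that(2) by (simp add: tendsto_cong)
  qed
  have "(a \<longlongrightarrow> a_inf) at_top"
    by (rule root) (use a_pos inf in auto, use dist in fastforce)
  moreover have "(b \<longlongrightarrow> b_inf) at_top"
    by (rule root) (use b_pos inf in auto, use dist in fastforce)
  ultimately show ?thesis
    using Cr en unfolding Ef by (intro conjI tendsto_Pair) blast+
qed

end
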